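(* Under the setting described in the context, for any point $\vec u=(u_1,\dots,u_k)\in\mathcal W^0\cap\mathcal L$ we have the exact formula \[ P_n^+(\vec u) = \frac{(2\pi)^{-k}}{k!} \int\cdots\int\limits_{|z_1|=\dots=|z_k|=\rho} \det_{1\le j,m\le k}(z_j^m)\det_{1\le j,m\le k}(z_j^{-m}) \frac{\det\limits_{1\le j,m\le k}\left( z_j^{u_m}-z_j^{-u_m} \right)}{\det\limits_{1\le j,m\le k}\left( z_j^{m}-z_j^{-m} \right)} S(z_1,\dots,z_k)^n\left( \prod_{j=1}^{k}\frac{(z_j+1)dz_j}{z_j}\right), \] where $\rho>0$.
   Context: Let $k\ge1$ and $\mathcal W^0=\{(x_1,\dots,x_k)\in\mathbb{R}^k: 0<x_1<\dots<x_k\}$. The atomic step set $\mathcal A$ is one of $\{\pm\vec e^{(1)},\dots,\pm\vec e^{(k)}\}$ or $\{\sum_{j=1}^k\varepsilon_j\vec e^{(j)}:\varepsilon_j\in\{-1,+1\}\}$ (canonical basis $\vec e^{(j)}$), and $\mathcal L$ is the $\mathbb{Z}$-lattice spanned by $\mathcal A$. The composite step set $\mathcal S$ is a finite set of finite sequences of atomic steps such that whenever $(\vec a_1,\dots,\vec a_m)\in\mathcal S$, also $(\rho(\vec a_1),\dots,\rho(\vec a_j),\vec a_{j+1},\dots,\vec a_m)\in\mathcal S$ for all $j$ and all $\rho$ in the reflection group (of type $B_k$) generated by reflections in the hyperplanes $x_i=x_j$ ($i<j$) and $x_1=0$; the weight function $w:\mathcal S\to\mathbb{R}_+$ is invariant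 under the same operations. The composite step generating function is $S(z_1,\dots,z_k)=\sum_{(\vec a_1,\dots,\vec a_m)\in\mathcal S}w((\vec a_1,\dots,\vec a_m))\vec z^{\vec a_1+\dots+\vec a_m}$. $P_n^+(\vec u\to\vec v)$ is the weighted count (product of weights of steps) of $n$-step walks from $\vec u$ to $\vec v$ with steps from $\mathcal S$ that stay within $\mathcal W^0$, and $P_n^+(\vec u)=\sum_{\vec v\in\mathcal W^0}P_n^+(\vec u\to\vec v)$ is the weighted count of $n$-step walks starting at $\vec u$ staying in $\mathcal W^0$ with free end point.
   Formalization: The prefactor (2π)^{-k}/k! is corrected to (2πi)^{-k}/k!, since with complex line elements dz_j the printed formula is off by i^k (k=1, n=0, u=1 gives i instead of 1); staying within W^0 is required after every atomic step. *)

theory Defs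
  imports
    "HOL-Complex_Analysis.Contour_Integration"
    "Jordan_Normal_Form.Determinant"
begin

text \<open>
  Vectors and matrices are those of \<^theory>\<open>Jordan_Normal_Form.Matrix\<close>, whose dimension is a
  natural number. They are indexed from 0, so the coordinate called \<open>x\<^sub>j\<close> in the usual
  1-based notation is component \<open>j - 1\<close>.
\<close>

hide_type (open) Finite_Cartesian_Product.vec
hide_const (open) Finite_Cartesian_Product.vec Finite_Cartesian_Product.vec_nth
  Finite_Cartesian_Product.mat Determinants.det

no_notation Finite_Cartesian_Product.vec_nth (infixl \<open>$\<close> 90)

definition weyl_chamber :: "nat \<Rightarrow> real vec set" where
  "weyl_chamber k =
     {x \<in> carrier_vec k. (\<forall>i<k. 0 < x $ i) \<and> (\<forall>i j. i < j \<and> j < k \<longrightarrow> x $ i < x $ j)}"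

subsection \<open>Atomic steps, their lattice, and the reflection group\<close>

definition axis_steps :: "nat \<Rightarrow> real vec set" where
  "axis_steps k = (\<Union>j<k. {unit_vec k j, - unit_vec k j})"

definition diagonal_steps :: "nat \<Rightarrow> real vec set" where
  "diagonal_steps k = {vec k \<epsilon> | \<epsilon>. \<forall>j<k. \<epsilon> j \<in> {-1, 1}}"

inductive_set lattice_span :: "nat \<Rightarrow> real vec set \<Rightarrow> real vec set"
  for k :: nat and A :: "real vec set" where
  zero: "0\<^sub>v k \<in> lattice_span k A"
| add: "x \<in> lattice_span k A \<Longrightarrow> a \<in> A \<Longrightarrow> x + a \<in> lattice_span k A"
| diff: "x \<in> lattice_span k A \<Longrightarrow> a \<in> A \<Longrightarrow> x - a \<in> lattice_span k A"

text \<open>Orthogonal reflection in the hyperplane with normal vector \<open>\<alpha>\<close>.\<close>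

definition reflection :: "real vec \<Rightarrow> real vec \<Rightarrow> real vec" where
  "reflection \<alpha> x = x - (2 * scalar_prod x \<alpha> / scalar_prod \<alpha> \<alpha>) \<cdot>\<^sub>v \<alpha>"

text \<open>Normal vectors of the hyperplanes \<open>x\<^sub>i = x\<^sub>j\<close> (\<open>i < j\<close>) and \<open>x\<^sub>1 = 0\<close>.\<close>

definition wall_normals :: "nat \<Rightarrow> real vec set" where
  "wall_normals k =
     {unit_vec k i - unit_vec k j | i j. i < j \<and> j < k} \<union> {unit_vec k 0}"

text \<open>Reflections are involutions, so closure under composition already yields the group.\<close>

inductive_set reflection_group :: "nat \<Rightarrow> (real vec \<Rightarrow> real vec) set" for k :: nat where
  id: "id \<in> reflection_group k"
| comp: "\<alpha> \<in> wall_normals k \<Longrightarrow> g \<in> reflection_group k \<Longrightarrow> reflection \<alpha> \<circ> g \<in> reflection_group k"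

subsection \<open>Composite steps\<close>

definition reflect_prefix :: "(real vec \<Rightarrow> real vec) \<Rightarrow> nat \<Rightarrow> real vec list \<Rightarrow> real vec list" where
  "reflect_prefix g j as = map g (take j as) @ drop j as"

definition composite_step_set :: "nat \<Rightarrow> real vec set \<Rightarrow> real vec list set \<Rightarrow> bool" where
  "composite_step_set k A S \<longleftrightarrow>
     finite S \<and> S \<subseteq> lists A \<and>
     (\<forall>as\<in>S. \<forall>g\<in>reflection_group k. \<forall>j\<le>length as. reflect_prefix g j as \<in> S)"

definition step_weight :: "nat \<Rightarrow> real vec list set \<Rightarrow> (real vec list \<Rightarrow> real) \<Rightarrow> bool" where
  "step_weight k S w \<longleftrightarrow>
     (\<forall>as\<in>S. 0 \<le> w as) \<and>
     (\<forall>as\<in>S. \<forall>g\<in>reflection_group k. \<forall>j\<le>length as. w (reflect_prefix g j as) = w as)"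

text \<open>
  The coordinates of a sum of atomic steps are integers, so taking their floor only turns
  them into integer exponents.
\<close>

definition step_gf ::
  "nat \<Rightarrow> real vec list set \<Rightarrow> (real vec list \<Rightarrow> real) \<Rightarrow> complex vec \<Rightarrow> complex" where
  "step_gf k S w z =
     (\<Sum>as\<in>S. complex_of_real (w as) * (\<Prod>i<k. (z $ i) powi \<lfloor>foldl (+) (0\<^sub>v k) as $ i\<rfloor>))"

subsection \<open>Walks in the Weyl chamber\<close>

text \<open>
  A walk is the list of its composite steps. It stays in the chamber if every point reached
  after an atomic step does, including the points in the interior of a composite step.
\<close>

definition walks_in_chamber ::
  "nat \<Rightarrow> real vec list set \<Rightarrow> nat \<Rightarrow> real vec \<Rightarrow> real vec \<Rightarrow> real vec list list set" where
  "walks_in_chamber k S n u v =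
     {ss. length ss = n \<and> set ss \<subseteq> S \<and> foldl (+) u (concat ss) = v \<and>
          (\<forall>i\<le>length (concat ss). foldl (+) u (take i (concat ss)) \<in> weyl_chamber k)}"

definition walk_count ::
  "nat \<Rightarrow> real vec list set \<Rightarrow> (real vec list \<Rightarrow> real) \<Rightarrow> nat \<Rightarrow> real vec \<Rightarrow> real vec \<Rightarrow> real" where
  "walk_count k S w n u v = (\<Sum>ss\<in>walks_in_chamber k S n u v. prod_list (map w ss))"

text \<open>Only finitely many end points contribute to the sum.\<close>

definition free_walk_count ::
  "nat \<Rightarrow> real vec list set \<Rightarrow> (real vec list \<Rightarrow> real) \<Rightarrow> nat \<Rightarrow> real vec \<Rightarrow> real" where
  "free_walk_count k S w n u = (\<Sum>\<^sub>\<infinity>v\<in>weyl_chamber k. walk_count k S w n u v)"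

subsection \<open>Integration over a torus\<close>

text \<open>
  The \<open>k\<close>-fold iterated contour integral of \<open>f dz\<^sub>1 \<dots> dz\<^sub>k\<close> over
  \<open>\<bar>z\<^sub>1\<bar> = \<dots> = \<bar>z\<^sub>k\<bar> = r\<close>, each circle being traversed once counterclockwise.
  Since \<open>dz / z\<close> is the complex form, with integral \<open>2 \<pi> \<i>\<close> over a circle, the matching
  normalisation is \<open>(2 \<pi> \<i>)\<^bsup>-k\<^esup>\<close>. A quotient of determinants with denominator \<open>0\<close> has the
  value \<open>0\<close>; for \<open>det (z\<^sub>j\<^bsup>m\<^esup> - z\<^sub>j\<^bsup>-m\<^esup>)\<close> this happens only on a null set of the torus.
\<close>

fun torus_integral :: "real \<Rightarrow> nat \<Rightarrow> (complex vec \<Rightarrow> complex) \<Rightarrow> complex" where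
  "torus_integral r 0 f = f vNil"
| "torus_integral r (Suc k) f =
     contour_integral (circlepath 0 r) (\<lambda>z. torus_integral r k (\<lambda>v. f (vCons z v)))"

abbreviation det_of :: "nat \<Rightarrow> (nat \<Rightarrow> nat \<Rightarrow> complex) \<Rightarrow> complex" where
  "det_of k f \<equiv> Determinant.det (Matrix.mat k k (\<lambda>(j, m). f j m))"

end

theory Submission
  imports Defs
begin

text \<open>
  Write \<open>a\<^sub>u(z) = det(z\<^sub>j\<^bsup>u\<^sub>m\<^esup> - z\<^sub>j\<^bsup>-u\<^sub>m\<^esup>)\<close>. The step generating function \<open>S\<close> is invariant under the
  reflection group, so \<open>a\<^sub>u S\<close> is the weighted sum of \<open>a\<close> over the end points of all composite steps
  from \<open>u\<close>. Steps that leave the chamber first hit a wall, and reflecting what follows cancels them in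
  pairs. Hence \<open>a\<^sub>u S = \<Sum>\<^sub>v P\<^sub>1\<^sup>+(u \<rightarrow> v) a\<^sub>v\<close>, and induction on \<open>n\<close> reduces the theorem to \<open>n = 0\<close>.

  The Vandermonde and symplectic denominators are products, so for \<open>n = 0\<close> the integrand is
  \<open>a\<^sub>u(z)\<close> times \<open>\<Prod>\<^bsub>i<j\<^esub> (z\<^sub>i - z\<^sub>j)/(z\<^sub>i z\<^sub>j - 1) \<Prod>\<^sub>j 1/(z\<^sub>j - 1)\<close>. Expand \<open>a\<^sub>u\<close> along the row of the last
  variable and decompose the kernel into partial fractions in that variable. Every contour integral
  that occurs is then one of a Laurent polynomial. The pole at 1 leads to the same integral with one
  variable less, the pole at \<open>1/z\<^sub>i\<close> to the product of an integral over \<open>z\<^sub>i\<close> and the same integral with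
  two variables less, and the signs add up to \<open>k!\<close>.
\<close>

subsection \<open>Iterated contour integrals over a torus\<close>

text \<open>The circle is a simple path, so it meets a finite set for only finitely many parameters,
  and changing the integrand there is negligible. Agreement is asked for away from 0, which a circle
  of positive radius avoids.\<close>

lemma has_contour_integral_spike_circlepath:
  assumes "(f has_contour_integral i) (circlepath 0 r)" "r > 0" "finite A"
    and eq: "\<And>z. z \<noteq> 0 \<Longrightarrow> z \<notin> A \<Longrightarrow> f z = g z"
  shows "(g has_contour_integral i) (circlepath 0 r)"
proof -
  let ?p = "circlepath 0 r"
  have sp: "simple_path ?p" using assms(2) by (simp add: simple_path_circlepath)
  have "finite {x \<in> {0<..<1}. ?p x \<in> A}"
    using finite_vimage_IntI[OF \<open>finite A\<close> simple_path_inj_on[OF sp]]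
    by (auto simp: vimage_def conj_commute Int_def)
  then have neg: "negligible ({0,1} \<union> {x \<in> {0<..<1}. ?p x \<in> A})"
    by (intro negligible_finite) auto
  have nz: "?p x \<noteq> 0" for x
    using assms(2) by (simp add: circlepath)
  show ?thesis
    unfolding has_contour_integral_def
    by (rule has_integral_spike[OF neg _ assms(1)[unfolded has_contour_integral_def]])
       (use nz eq in \<open>auto simp: less_eq_real_def\<close>)
qed

text \<open>For \<open>e = -1\<close> this is Cauchy's formula for a constant. Every other power has
  a primitive off 0, and the path is closed.\<close>

lemma has_contour_integral_powi_circlepath:
  assumes "r > 0"
  shows "((\<lambda>z. z powi e) has_contour_integral (if e = -1 then 2 * of_real pi * \<i> else 0))
           (circlepath 0 r)"
proof (cases "e = -1")
  case True
  have "(\<lambda>w. 1 / (w - 0)) contour_integrable_on circlepath 0 r"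
    using assms by (intro contour_integrable_continuous_circlepath continuous_intros)
      auto
  then have "((\<lambda>w. 1 / (w - 0)) has_contour_integral 2 * of_real pi * \<i>) (circlepath 0 r)"
    using contour_integral_circlepath[OF assms, of 0] has_contour_integral_integral by metis
  then show ?thesis using True by (simp add: field_simps)
next
  case False
  have *: "((\<lambda>z::complex. z powi (e+1) / of_int (e+1)) has_field_derivative z powi e) (at z within -{0})"
    if "z \<in> -{0}" for z
  proof -
    have nz: "of_int (e + 1) \<noteq> (0 :: complex)"
      using False by (metis add_diff_cancel_right' diff_0 of_int_eq_0_iff)
    have "((\<lambda>z::complex. z powi (e+1)) has_field_derivative of_int (e+1) * z powi e) (at z within -{0})"
      using that by (auto intro!: derivative_eq_intros)
    from DERIV_cdivide[OF this, of "of_int (e+1)"] show ?thesis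
      using nz by (simp del: of_int_add)
  qed
  have "((\<lambda>z. z powi e) has_contour_integral
     (\<lambda>z. z powi (e+1) / of_int (e+1)) (pathfinish (circlepath 0 r)) -
     (\<lambda>z. z powi (e+1) / of_int (e+1)) (pathstart (circlepath 0 r))) (circlepath 0 r)"
    by (rule contour_integral_primitive[OF *]) (use assms in \<open>auto simp: path_image_circlepath\<close>)
  then show ?thesis using False by simp
qed

text \<open>
  Points of \<open>\<complex>\<^sup>k\<close> are functions on all of \<open>nat\<close>; coordinates from \<open>k\<close> on are junk and set to 0.
  Null sets are handled coordinatewise: for all but finitely many values of the first
  coordinate, the condition holds generically in the remaining ones.
\<close>

primrec generic :: "nat \<Rightarrow> ((nat \<Rightarrow> complex) \<Rightarrow> bool) \<Rightarrow> bool" where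
  "generic 0 P \<longleftrightarrow> P (\<lambda>_. 0)"
| "generic (Suc k) P \<longleftrightarrow> finite {z. \<not> generic k (\<lambda>x. P (case_nat z x))}"

text \<open>A relation rather than a value, so that existence of the integrals is part of the claim.
  \<open>F\<close> collects the inner integrals; finitely many outer points may fail, which absorbs
  the points where some denominator is 0.\<close>

primrec has_torus_integral ::
  "real \<Rightarrow> nat \<Rightarrow> ((nat \<Rightarrow> complex) \<Rightarrow> complex) \<Rightarrow> complex \<Rightarrow> bool" where
  "has_torus_integral r 0 f c \<longleftrightarrow> f (\<lambda>_. 0) = c"
| "has_torus_integral r (Suc k) f c \<longleftrightarrow>
     (\<exists>F. (F has_contour_integral c) (circlepath 0 r) \<and>
          finite {z. \<not> has_torus_integral r k (\<lambda>x. f (case_nat z x)) (F z)})"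

lemma generic_mono:
  assumes "generic k P" "\<And>x. P x \<Longrightarrow> Q x"
  shows "generic k Q"
  using assms
proof (induction k arbitrary: P Q)
  case (Suc k)
  have "{z. \<not> generic k (\<lambda>x. Q (case_nat z x))} \<subseteq> {z. \<not> generic k (\<lambda>x. P (case_nat z x))}"
    using Suc.IH[of "\<lambda>x. P (case_nat _ x)" "\<lambda>x. Q (case_nat _ x)"] Suc.prems(2) by auto
  then show ?case using Suc.prems(1) finite_subset by auto
qed auto

text \<open>These are the points where the denominators of \<open>kern\<close> and
  \<open>pf_coeff\<close>, the negative powers of the coordinates and the symplectic denominator
  cause no trouble.\<close>

definition regular :: "nat \<Rightarrow> (nat \<Rightarrow> complex) \<Rightarrow> bool" where
  "regular k x \<longleftrightarrow> (\<forall>j<k. x j \<noteq> 0 \<and> x j \<noteq> 1 \<and> x j \<noteq> -1 \<and> (\<forall>i<j. x i \<noteq> x j \<and> x i * x j \<noteq> 1))"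

lemma generic_regular: "generic k (regular k)"
proof -
  \<comment> \<open>The claim is strengthened by a finite set \<open>M\<close> of forbidden values:
    once the first coordinate is \<open>z\<close>, the remaining ones must also avoid
    \<open>z\<close> and \<open>1/z\<close>.\<close>
  have "finite M \<Longrightarrow> generic k (\<lambda>x. regular k x \<and> (\<forall>j<k. x j \<notin> M))" for M
  proof (induction k arbitrary: M)
    case (Suc k)
    have "generic k (\<lambda>x. regular (Suc k) (case_nat z x) \<and> (\<forall>j<Suc k. case_nat z x j \<notin> M))"
      if "z \<notin> M \<union> {0,1,-1}" for z
    proof (rule generic_mono)
      show "generic k (\<lambda>x. regular k x \<and> (\<forall>j<k. x j \<notin> M \<union> {z, 1/z}))"
        using Suc.IH[of "M \<union> {z, 1/z}"] Suc.prems by blast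
      fix x assume x: "regular k x \<and> (\<forall>j<k. x j \<notin> M \<union> {z, 1/z})"
      have "z \<noteq> x j" if "j < k" for j
        using x that by blast
      moreover have "z * x j \<noteq> 1" if "j < k" for j
      proof
        assume "z * x j = 1"
        moreover from this have "z \<noteq> 0" by auto
        ultimately have "x j = 1 / z" by (simp add: field_simps)
        then show False using x that by blast
      qed
      ultimately show "regular (Suc k) (case_nat z x) \<and> (\<forall>j<Suc k. case_nat z x j \<notin> M)"
        using x that unfolding regular_def by (auto simp: less_Suc_eq_0_disj)
    qed
    then have "{z. \<not> generic k (\<lambda>x. regular (Suc k) (case_nat z x) \<and> (\<forall>j<Suc k. case_nat z x j \<notin> M))}
       \<subseteq> M \<union> {0,1,-1}" by blast
    then show ?case using Suc.prems finite_subset[of _ "M \<union> {0,1,-1}"] by simp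
  qed (simp add: regular_def)
  from this[of "{}"] show ?thesis by simp
qed

lemma has_torus_integral_cong:
  assumes "has_torus_integral r k f c" "generic k (\<lambda>x. f x = g x)"
  shows "has_torus_integral r k g c"
  using assms
proof (induction k arbitrary: f g c)
  case (Suc k)
  then obtain F where F: "(F has_contour_integral c) (circlepath 0 r)"
    and fin: "finite {z. \<not> has_torus_integral r k (\<lambda>x. f (case_nat z x)) (F z)}" by auto
  have "{z. \<not> has_torus_integral r k (\<lambda>x. g (case_nat z x)) (F z)} \<subseteq>
    {z. \<not> has_torus_integral r k (\<lambda>x. f (case_nat z x)) (F z)} \<union>
    {z. \<not> generic k (\<lambda>x. f (case_nat z x) = g (case_nat z x))}"
    using Suc.IH[of "\<lambda>x. f (case_nat _ x)" _ "\<lambda>x. g (case_nat _ x)"] by blast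
  then have "finite {z. \<not> has_torus_integral r k (\<lambda>x. g (case_nat z x)) (F z)}"
    using fin Suc.prems(2) finite_subset by auto
  then show ?case using F by auto
qed auto

lemma has_torus_integral_cmult:
  assumes "has_torus_integral r k f c"
  shows "has_torus_integral r k (\<lambda>x. a * f x) (a * c)"
  using assms
proof (induction k arbitrary: f c)
  case (Suc k)
  then obtain F where F: "(F has_contour_integral c) (circlepath 0 r)"
    and fin: "finite {z. \<not> has_torus_integral r k (\<lambda>x. f (case_nat z x)) (F z)}" by auto
  have "{z. \<not> has_torus_integral r k (\<lambda>x. a * f (case_nat z x)) (a * F z)} \<subseteq>
    {z. \<not> has_torus_integral r k (\<lambda>x. f (case_nat z x)) (F z)}"
    using Suc.IH by blast
  then have "finite {z. \<not> has_torus_integral r k (\<lambda>x. a * f (case_nat z x)) (a * F z)}"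
    using fin finite_subset by auto
  then show ?case using has_contour_integral_lmul[OF F, of a] by auto
qed auto

lemma has_torus_integral_0: "has_torus_integral r k (\<lambda>_. 0) 0"
proof (induction k)
  case (Suc k)
  show ?case unfolding has_torus_integral.simps
    by (rule exI[of _ "\<lambda>_. 0"]) (use Suc in \<open>auto simp: has_contour_integral_0\<close>)
qed auto

lemma has_torus_integral_add:
  assumes "has_torus_integral r k f c" "has_torus_integral r k g d"
  shows "has_torus_integral r k (\<lambda>x. f x + g x) (c + d)"
  using assms
proof (induction k arbitrary: f c g d)
  case (Suc k)
  then obtain F G where F: "(F has_contour_integral c) (circlepath 0 r)"
    and finF: "finite {z. \<not> has_torus_integral r k (\<lambda>x. f (case_nat z x)) (F z)}"
    and G: "(G has_contour_integral d) (circlepath 0 r)"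
    and finG: "finite {z. \<not> has_torus_integral r k (\<lambda>x. g (case_nat z x)) (G z)}" by auto
  have "{z. \<not> has_torus_integral r k (\<lambda>x. f (case_nat z x) + g (case_nat z x)) (F z + G z)} \<subseteq>
    {z. \<not> has_torus_integral r k (\<lambda>x. f (case_nat z x)) (F z)} \<union>
    {z. \<not> has_torus_integral r k (\<lambda>x. g (case_nat z x)) (G z)}"
    using Suc.IH by blast
  then have "finite {z. \<not> has_torus_integral r k (\<lambda>x. f (case_nat z x) + g (case_nat z x)) (F z + G z)}"
    using finF finG finite_subset by auto
  then show ?case using has_contour_integral_add[OF F G] by auto
qed auto

lemma has_torus_integral_sum:
  assumes "finite I" "\<And>i. i \<in> I \<Longrightarrow> has_torus_integral r k (f i) (c i)"
  shows "has_torus_integral r k (\<lambda>x. \<Sum>i\<in>I. f i x) (\<Sum>i\<in>I. c i)"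
  using assms
  by (induction I rule: finite_induct) (auto intro: has_torus_integral_0 has_torus_integral_add)

text \<open>By induction the values \<open>F z\<close> agree with the inner
  \<open>torus_integral\<close> for all but finitely many \<open>z\<close>, so the outer contour
  integral is the same.\<close>

lemma torus_integral_eqI:
  assumes "has_torus_integral r k (\<lambda>x. f (vec k x)) c" "r > 0"
  shows "torus_integral r k f = c"
  using assms(1)
proof (induction k arbitrary: f c)
  case 0
  have "vec 0 (\<lambda>_. 0) = (vNil :: complex vec)" by auto
  with 0 show ?case by simp
next
  case (Suc k)
  have vc: "vec (Suc k) (case_nat z x) = vCons z (vec k x)" for z :: complex and x
    by (rule eq_vecI) (auto simp: vCons_def split: nat.splits)
  obtain F where F: "(F has_contour_integral c) (circlepath 0 r)"
    and fin: "finite {z. \<not> has_torus_integral r k (\<lambda>x. f (vCons z (vec k x))) (F z)}"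
    using Suc.prems by (auto simp: vc)
  have "((\<lambda>z. torus_integral r k (\<lambda>v. f (vCons z v))) has_contour_integral c) (circlepath 0 r)"
    by (rule has_contour_integral_spike_circlepath[OF F assms(2) fin])
       (use Suc.IH in \<open>auto simp: eq_commute\<close>)
  then show ?case by (simp add: contour_integral_unique)
qed

text \<open>The recursion peels off the first coordinate as the outermost one. The last coordinate
  is therefore innermost and can be integrated first without interchanging integrals.\<close>

lemma has_torus_integral_last:
  assumes "has_torus_integral r k F c"
    and "generic k (\<lambda>x. ((\<lambda>t. f (x(k := t))) has_contour_integral F x) (circlepath 0 r))"
  shows "has_torus_integral r (Suc k) f c"
  using assms
proof (induction k arbitrary: f F c)
  case 0
  have "(\<lambda>_. 0)(0 := t) = case_nat t (\<lambda>_. 0 :: complex)" for t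
    by (auto split: nat.splits)
  with 0 show ?case
    by (auto simp del: fun_upd_apply simp: fun_upd_def[symmetric] intro!: exI[of _ "\<lambda>z. f (case_nat z (\<lambda>_. 0))"])
next
  case (Suc k)
  obtain G where G: "(G has_contour_integral c) (circlepath 0 r)"
    and fin: "finite {z. \<not> has_torus_integral r k (\<lambda>x. F (case_nat z x)) (G z)}"
    using Suc.prems by auto
  have upd: "(case_nat z x)(Suc k := t) = case_nat z (x(k := t))" for z t :: complex and x
    by (auto split: nat.splits)
  have "{z. \<not> has_torus_integral r (Suc k) (\<lambda>x. f (case_nat z x)) (G z)} \<subseteq>
    {z. \<not> has_torus_integral r k (\<lambda>x. F (case_nat z x)) (G z)} \<union>
    {z. \<not> generic k (\<lambda>x. ((\<lambda>t. f (case_nat z (x(k := t)))) has_contour_integral F (case_nat z x)) (circlepath 0 r))}"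
    by (auto simp del: has_torus_integral.simps generic.simps
        intro!: Suc.IH[where F = "\<lambda>x. F (case_nat _ x)"])
  then have "finite {z. \<not> has_torus_integral r (Suc k) (\<lambda>x. f (case_nat z x)) (G z)}"
    by (rule finite_subset) (use fin Suc.prems(2) in \<open>simp add: upd del: fun_upd_apply\<close>)
  with G show ?case unfolding has_torus_integral.simps(2)[of r "Suc k"] by blast
qed

text \<open>The increasing enumeration of all numbers other than \<open>i\<close>: composing with it
  deletes a coordinate of \<open>x\<close> or a column of a minor.\<close>

definition skip :: "nat \<Rightarrow> nat \<Rightarrow> nat" where
  "skip i j = (if j < i then j else Suc j)"

text \<open>Induction on \<open>i\<close>. For \<open>i = 0\<close> the separated factor is constant
  in the inner integrals; otherwise the outermost variable belongs to \<open>h\<close>, and the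
  constant \<open>d\<close> passes through its integral.\<close>

lemma has_torus_integral_prod:
  assumes "has_torus_integral r k h c" "(g has_contour_integral d) (circlepath 0 r)" "i \<le> k"
  shows "has_torus_integral r (Suc k) (\<lambda>x. g (x i) * h (x \<circ> skip i)) (d * c)"
  using assms(1,3)
proof (induction i arbitrary: k h c)
  case 0
  have "case_nat z x \<circ> skip 0 = x" for z :: complex and x
    by (auto simp: skip_def)
  moreover have "has_torus_integral r k (\<lambda>x. g z * h x) (g z * c)" for z
    using 0 by (intro has_torus_integral_cmult)
  ultimately show ?case using has_contour_integral_rmul[OF assms(2), of c]
    by (auto simp del: comp_apply intro!: exI[of _ "\<lambda>z. g z * c"])
next
  case (Suc i)
  then obtain k' where k': "k = Suc k'" "i \<le> k'" by (cases k) auto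
  obtain H where H: "(H has_contour_integral c) (circlepath 0 r)"
    and fin: "finite {z. \<not> has_torus_integral r k' (\<lambda>x. h (case_nat z x)) (H z)}"
    using Suc.prems k' by auto
  have cn: "case_nat z x \<circ> skip (Suc i) = case_nat z (x \<circ> skip i)" for z :: complex and x
    by (auto simp: skip_def split: nat.splits)
  have "{z. \<not> has_torus_integral r k (\<lambda>x. g (x i) * h (case_nat z (x \<circ> skip i))) (d * H z)} \<subseteq>
    {z. \<not> has_torus_integral r k' (\<lambda>x. h (case_nat z x)) (H z)}"
    using Suc.IH k' by blast
  then have "finite {z. \<not> has_torus_integral r k (\<lambda>x. g (x i) * h (case_nat z (x \<circ> skip i))) (d * H z)}"
    using fin finite_subset by auto
  with has_contour_integral_lmul[OF H, of d] show ?case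
    by (auto simp: cn simp del: comp_apply intro!: exI[of _ "\<lambda>z. d * H z"])
qed

subsection \<open>The integral for walks without steps\<close>

lemma sum_powi_mult_one_minus:
  fixes y :: complex
  assumes "y \<noteq> 0"
  shows "(1 - y) * (\<Sum>j<N. y powi (a + int j)) = y powi a - y powi (a + int N)"
proof (induction N)
  case (Suc N)
  have step: "y powi (a + int (Suc N)) = y * y powi (a + int N)"
    using power_int_add_1[of y "a + int N"] assms by (simp add: algebra_simps)
  have "(1 - y) * (\<Sum>j<Suc N. y powi (a + int j)) = y powi a - y powi (a + int N) + (1 - y) * y powi (a + int N)"
    using Suc by (simp only: sum.lessThan_Suc distrib_left)
  also have "\<dots> = y powi a - y powi (a + int (Suc N))"
    unfolding step by (simp add: algebra_simps)
  finally show ?case .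
qed auto

text \<open>Only the exponent -1 contributes, that is the index \<open>j = -1 - a\<close> if it lies
  in the range.\<close>

lemma has_contour_integral_sum_powi:
  assumes "r > 0"
  shows "((\<lambda>t. \<Sum>j<N. c j * t powi (a + int j)) has_contour_integral
     (if a \<le> -1 \<and> -1 < a + int N then c (nat (-1-a)) * (2 * of_real pi * \<i>) else 0)) (circlepath 0 r)"
proof -
  have "((\<lambda>t. \<Sum>j<N. c j * t powi (a + int j)) has_contour_integral
     (\<Sum>j<N. c j * (if a + int j = -1 then 2 * of_real pi * \<i> else 0))) (circlepath 0 r)"
    by (intro has_contour_integral_sum has_contour_integral_lmul has_contour_integral_powi_circlepath assms) auto
  also have "(\<Sum>j<N. c j * (if a + int j = -1 then 2 * of_real pi * \<i> else 0)) =
     (\<Sum>j<N. if j = nat (-1-a) then (if a \<le> -1 then c j * (2 * of_real pi * \<i>) else 0) else 0)"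
    by (intro sum.cong) auto
  also have "\<dots> = (if a \<le> -1 \<and> -1 < a + int N then c (nat (-1-a)) * (2 * of_real pi * \<i>) else 0)"
    by auto
  finally show ?thesis .
qed

text \<open>The numerator vanishes at 1, so the pole is removable: the quotient is a Laurent
  polynomial with exponents from \<open>-b\<close> to \<open>b - 1\<close>, and its integral does
  not depend on the radius.\<close>

lemma powi_diff_div_one_minus:
  fixes t :: complex
  assumes "t \<noteq> 0" "t \<noteq> 1" "b \<ge> 0"
  shows "(t powi b - t powi (-b)) / (1 - t) = - (\<Sum>j<nat (2*b). t powi (-b + int j))"
proof -
  have "(1 - t) * (\<Sum>j<nat (2*b). t powi (-b + int j)) = t powi (-b) - t powi b"
    using sum_powi_mult_one_minus[OF assms(1), of "-b" "nat (2*b)"] assms(3) by simp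
  then show ?thesis using assms(2) by (simp add: field_simps)
qed

lemma contour_integral_row_pole_one:
  assumes "r > 0" "b > 0"
  shows "((\<lambda>t. (t powi b - t powi (-b)) / (1 - t)) has_contour_integral - (2 * of_real pi * \<i>)) (circlepath 0 r)"
proof (rule has_contour_integral_spike_circlepath)
  show "((\<lambda>t. - (\<Sum>j<nat (2*b). 1 * t powi (-b + int j))) has_contour_integral - (2 * of_real pi * \<i>)) (circlepath 0 r)"
    using has_contour_integral_neg[OF has_contour_integral_sum_powi[OF assms(1), where N = "nat (2*b)" and c = "\<lambda>_. 1" and a = "-b"]] assms
    by (simp split: if_splits)
  show "finite {1::complex}" by simp
qed (use assms powi_diff_div_one_minus in auto)

text \<open>Subtracting the value at \<open>inverse x\<close> removes the pole there. In
  \<open>y = x * t\<close> the quotient splits into two geometric sums, one from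
  \<open>t powi b\<close> and one from \<open>t powi (-b)\<close>; only the second has a term of
  exponent -1, at \<open>j = b - 1\<close>.\<close>

lemma contour_integral_row_pole:
  fixes x :: complex
  assumes "r > 0" "b > 0" "x \<noteq> 0"
  shows "((\<lambda>t. (t powi b - t powi (-b) - (inverse x powi b - inverse x powi (-b))) / (1 - x * t))
     has_contour_integral - (x powi (b - 1) * (2 * of_real pi * \<i>))) (circlepath 0 r)"
proof (rule has_contour_integral_spike_circlepath)
  let ?I = "2 * of_real pi * \<i> :: complex"
  have 1: "((\<lambda>t. - (x powi (-b)) * (\<Sum>j<nat b. x powi (0 + int j) * t powi (0 + int j))) has_contour_integral - (x powi (-b)) * 0) (circlepath 0 r)"
    using has_contour_integral_sum_powi[OF assms(1), where N = "nat b" and c = "\<lambda>j. x powi (0 + int j)" and a = 0]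
    by (intro has_contour_integral_lmul) simp
  have 2: "((\<lambda>t. - (x powi b) * (\<Sum>j<nat b. x powi (-b + int j) * t powi (-b + int j))) has_contour_integral
      - (x powi b) * (x powi (-1) * ?I)) (circlepath 0 r)"
    using has_contour_integral_sum_powi[OF assms(1), where N = "nat b" and c = "\<lambda>j. x powi (-b + int j)" and a = "-b"] assms(2)
    by (intro has_contour_integral_lmul) (simp split: if_splits)
  show "((\<lambda>t. - (x powi (-b)) * (\<Sum>j<nat b. x powi (0 + int j) * t powi (0 + int j)) +
       - (x powi b) * (\<Sum>j<nat b. x powi (-b + int j) * t powi (-b + int j))) has_contour_integral
     - (x powi (b - 1) * ?I)) (circlepath 0 r)"
    using has_contour_integral_add[OF 1 2] assms by (simp add: power_int_diff field_simps)
  show "finite {inverse x}" by simp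
  fix t :: complex assume t: "t \<noteq> 0" "t \<notin> {inverse x}"
  define y where "y = x * t"
  have y: "y \<noteq> 0" "y \<noteq> 1" using t assms by (auto simp: y_def field_simps)
  have s: "(\<Sum>j<nat b. x powi (a + int j) * t powi (a + int j)) = (y powi a - y powi (a + b)) / (1 - y)" for a
    using sum_powi_mult_one_minus[OF y(1), of a "nat b"] y assms(2)
    by (simp add: y_def power_int_mult_distrib field_simps)
  show "- (x powi (-b)) * (\<Sum>j<nat b. x powi (0 + int j) * t powi (0 + int j)) +
       - (x powi b) * (\<Sum>j<nat b. x powi (-b + int j) * t powi (-b + int j)) =
     (t powi b - t powi (-b) - (inverse x powi b - inverse x powi (-b))) / (1 - x * t)"
    unfolding s
    using assms t y
    by (simp add: y_def power_int_mult_distrib power_int_minus power_int_inverse divide_simps)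
       (simp add: algebra_simps)
qed (use assms in auto)

text \<open>Multiplying out \<open>(s powi a + s powi (-a)) * ((1 + s) / s)\<close> gives the
  exponents \<open>a-1\<close>, \<open>a\<close>, \<open>-a-1\<close> and \<open>-a\<close>. The
  geometric sum shifted by \<open>c\<close> contains the exponent -1 iff \<open>-b <= c < b\<close>,
  which holds for all four if \<open>a < b\<close> and for none if \<open>a > b\<close>.\<close>

lemma contour_integral_row_pair:
  assumes "r > 0" "a > 0" "b > 0" "a \<noteq> b"
  shows "((\<lambda>s. (s powi a + s powi (-a)) * (s powi b - s powi (-b)) * ((1 + s) / (1 - s)) / s)
     has_contour_integral (if a < b then - 4 * (2 * of_real pi * \<i>) else 0)) (circlepath 0 r)"
proof (rule has_contour_integral_spike_circlepath)
  let ?I = "2 * of_real pi * \<i> :: complex"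
  let ?f = "\<lambda>c s. \<Sum>j<nat (2*b). 1 * s powi (- b + c + int j)"
  have f: "(?f c has_contour_integral (if - b + c \<le> -1 \<and> -1 < b + c then ?I else 0)) (circlepath 0 r)" for c
    using has_contour_integral_sum_powi[OF assms(1), where N = "nat (2*b)" and c = "\<lambda>_. 1" and a = "- b + c"] assms by (auto split: if_splits)
  show "((\<lambda>s. - (?f (a-1) s + ?f a s + ?f (-a-1) s + ?f (-a) s))
     has_contour_integral (if a < b then - 4 * ?I else 0)) (circlepath 0 r)"
    using has_contour_integral_neg[OF has_contour_integral_add[OF has_contour_integral_add[OF has_contour_integral_add
       [OF f[of "a-1"] f[of a]] f[of "-a-1"]] f[of "-a"]]] assms
    by (auto split: if_splits simp: mult.commute)
  show "finite {1::complex}" by simp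
  fix s :: complex assume s: "s \<noteq> 0" "s \<notin> {1}"
  have f': "?f c s = s powi c * (\<Sum>j<nat (2*b). s powi (- b + int j))" for c
    using s by (auto simp: sum_distrib_left simp flip: power_int_add intro!: sum.cong arg_cong[where f = "power_int s"])
  have "(s powi a + s powi (-a)) * (s powi b - s powi (-b)) * ((1 + s) / (1 - s)) / s =
     (s powi a + s powi (-a)) * ((1 + s) / s) * ((s powi b - s powi (-b)) / (1 - s))"
    by (simp add: mult_ac)
  also have "\<dots> = - ((s powi a + s powi (-a)) * ((1 + s) / s) * (\<Sum>j<nat (2*b). s powi (- b + int j)))"
    using powi_diff_div_one_minus[of s b] s assms by simp
  also have "(s powi a + s powi (-a)) * ((1 + s) / s) = s powi (a-1) + s powi a + s powi (-a-1) + s powi (-a)"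
    using s by (simp add: power_int_diff field_simps)
  also have "- ((s powi (a-1) + s powi a + s powi (-a-1) + s powi (-a)) * (\<Sum>j<nat (2*b). s powi (- b + int j))) =
     - (?f (a-1) s + ?f a s + ?f (-a-1) s + ?f (-a) s)"
    unfolding f' by (simp add: algebra_simps)
  finally show "- (?f (a-1) s + ?f a s + ?f (-a-1) s + ?f (-a) s) =
    (s powi a + s powi (-a)) * (s powi b - s powi (-b)) * ((1 + s) / (1 - s)) / s" by simp
qed (use assms in auto)

text \<open>The numerator of Weyl's character formula for the symplectic group;
  \<open>u m = m + 1\<close> gives the denominator.\<close>

definition alternant :: "nat \<Rightarrow> (nat \<Rightarrow> int) \<Rightarrow> (nat \<Rightarrow> complex) \<Rightarrow> complex" where
  "alternant k u x = det_of k (\<lambda>j m. x j powi u m - x j powi (- u m))"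

text \<open>
  The product of the three determinants and of \<open>\<Prod>j. (x j + 1) / x j\<close> without the alternant of
  \<open>u\<close>, after cancellation of common factors; see \<open>integrand_eq_kern\<close>.
\<close>

definition kern :: "nat \<Rightarrow> (nat \<Rightarrow> complex) \<Rightarrow> complex" where
  "kern k x = (\<Prod>j<k. (\<Prod>i<j. (x i - x j) / (x i * x j - 1)) / (x j - 1))"

text \<open>
  Residue coefficients of the last factor of \<^const>\<open>kern\<close> as a rational function of the last
  variable, in the normalisation of \<open>partial_fractions\<close>.
\<close>

definition pf_coeff :: "nat \<Rightarrow> (nat \<Rightarrow> complex) \<Rightarrow> nat \<Rightarrow> complex" where
  "pf_coeff k x i = - (1 + x i) * (\<Prod>l\<in>{..<k} - {i}. (1 - x i * x l) / (x i - x l))"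

section \<open>Row expansion of alternants and partial fractions of the kernel\<close>

lemma alternant_cong:
  assumes "\<And>j. j < k \<Longrightarrow> x j = y j" "\<And>m. m < k \<Longrightarrow> u m = v m"
  shows "alternant k u x = alternant k v y"
  unfolding alternant_def by (rule arg_cong[where f = det], rule cong_mat) (use assms in auto)

lemma kern_cong:
  assumes "\<And>j. j < k \<Longrightarrow> x j = y j"
  shows "kern k x = kern k y"
  unfolding kern_def using assms by (intro prod.cong arg_cong2[where f = "(/)"]) auto

lemma alternant_expand_row:
  assumes "i \<le> k"
  shows "alternant (Suc k) u x =
    (\<Sum>m\<le>k. (-1) ^ (i + m) * (x i powi u m - x i powi (- u m)) * alternant k (u \<circ> skip m) (x \<circ> skip i))"
proof -
  let ?A = "Matrix.mat (Suc k) (Suc k) (\<lambda>(j, m). x j powi u m - x j powi (- u m))"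
  have "mat_delete ?A i m = Matrix.mat k k (\<lambda>(j, l). (x \<circ> skip i) j powi (u \<circ> skip m) l - (x \<circ> skip i) j powi (- (u \<circ> skip m) l))"
    if "m \<le> k" for m
    unfolding mat_delete_def by (rule eq_matI) (use that assms in \<open>auto simp: skip_def\<close>)
  moreover have "alternant (Suc k) u x = (\<Sum>m<Suc k. ?A $$ (i,m) * cofactor ?A i m)"
    unfolding alternant_def by (rule laplace_expansion_row) (use assms in auto)
  moreover have "?A $$ (i,m) = x i powi u m - x i powi (- u m)" if "m \<le> k" for m
    using that assms by simp
  ultimately show ?thesis
    unfolding alternant_def cofactor_def lessThan_Suc_atMost by (auto intro!: sum.cong)
qed

lemma alternant_eq_0:
  assumes "i < k" "j < k" "i \<noteq> j" "x i = x j"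
  shows "alternant k u x = 0"
  unfolding alternant_def
  by (rule det_identical_rows[of _ k i j]) (use assms in \<open>auto intro!: eq_vecI\<close>)

lemma regular_distinct:
  assumes "regular k x" "i < k" "j < k" "i \<noteq> j"
  shows "x i \<noteq> x j" "x i * x j \<noteq> 1"
  using assms unfolding regular_def by (metis nat_neq_iff mult.commute)+

text \<open>As a function of \<open>t\<close> the left side is a proper fraction with simple poles
  at 1 and at the points \<open>1 / x i\<close>. At \<open>t = 1\<close> every factor of the product
  equals 1, which explains the coefficient 1. The induction adds one factor at a time.\<close>

lemma partial_fractions:
  assumes "regular k x" "t \<noteq> 1" "\<And>i. i < k \<Longrightarrow> x i * t \<noteq> 1"
  shows "(\<Prod>i<k. (t - x i) / (1 - x i * t)) / (1 - t) = 1 / (1 - t) + (\<Sum>i<k. pf_coeff k x i / (1 - x i * t))"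
  using assms
proof (induction k arbitrary: t)
  case (Suc k)
  have reg: "regular k x" using Suc.prems(1) by (auto simp: regular_def)
  define z where "z = x k"
  have z: "z \<noteq> 0" "z \<noteq> 1" "z \<noteq> -1" and zx: "\<And>i. i < k \<Longrightarrow> x i \<noteq> z \<and> x i * z \<noteq> 1"
    and zt: "z * t \<noteq> 1"
    using Suc.prems unfolding z_def regular_def by auto
  have nz: "1 - z * t \<noteq> 0" "1 - t \<noteq> 0" "1 - z \<noteq> 0" "\<And>i. i < k \<Longrightarrow> 1 - x i * t \<noteq> 0"
     "\<And>i. i < k \<Longrightarrow> x i - z \<noteq> 0" "\<And>i. i < k \<Longrightarrow> z - x i \<noteq> 0"
    using z zx zt Suc.prems(2,3) by auto
  have old: "pf_coeff (Suc k) x i = pf_coeff k x i * ((1 - x i * z) / (x i - z))" if "i < k" for i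
  proof -
    have "{..<Suc k} - {i} = insert k ({..<k} - {i})" using that by auto
    then show ?thesis by (simp add: pf_coeff_def z_def)
  qed
  have s1: "1 - 1 / z \<noteq> 0" using z by simp
  have s2: "1 - x i / z \<noteq> 0" if "i < k" for i using zx[OF that] z by simp
  have "pf_coeff (Suc k) x k = - (1 + z) * (\<Prod>l<k. (1 - z * x l) / (z - x l))"
  proof -
    have "{..<Suc k} - {k} = {..<k}" by auto
    then show ?thesis by (simp add: pf_coeff_def z_def)
  qed
  \<comment> \<open>Up to a factor depending only on \<open>z\<close>, the coefficient of the new
    pole is the old fraction evaluated at \<open>t = 1 / z\<close>; the induction hypothesis at that
    point turns it into a sum over the old coefficients.\<close>
  also have "\<dots> = (1 - z\<^sup>2) / z * ((\<Prod>l<k. (1 / z - x l) / (1 - x l * (1 / z))) / (1 - 1 / z))"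
  proof -
    have "(\<Prod>l<k. (1 / z - x l) / (1 - x l * (1 / z))) = (\<Prod>l<k. (1 - z * x l) / (z - x l))"
      by (rule prod.cong) (use z zx nz in \<open>auto simp: divide_simps mult.commute\<close>)
    moreover have "(1 - z\<^sup>2) / z * (1 / (1 - 1 / z)) = - (1 + z)"
      using z s1 by (simp add: divide_simps) (simp add: power2_eq_square algebra_simps)
    ultimately show ?thesis by (metis (no_types, lifting) times_divide_eq_right mult.right_neutral mult.assoc mult.commute)
  qed
  also have "\<dots> = (1 - z\<^sup>2) / z * (1 / (1 - 1 / z) + (\<Sum>i<k. pf_coeff k x i / (1 - x i * (1 / z))))"
    using zx z by (subst Suc.IH[OF reg]) (auto simp: field_simps)
  also have "\<dots> = - (1 + z) + (\<Sum>i<k. pf_coeff k x i * ((1 - z\<^sup>2) / (z - x i)))"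
  proof -
    have "(1 - z\<^sup>2) / z * (1 / (1 - 1 / z)) = - (1 + z)"
      using z s1 by (simp add: divide_simps) (simp add: power2_eq_square algebra_simps)
    moreover have "(1 - z\<^sup>2) / z * (pf_coeff k x i / (1 - x i * (1 / z))) = pf_coeff k x i * ((1 - z\<^sup>2) / (z - x i))" if "i < k" for i
      using z nz(6)[OF that] by (simp add: divide_simps)
    ultimately show ?thesis by (simp add: distrib_left sum_distrib_left)
  qed
  finally have new: "pf_coeff (Suc k) x k = - (1 + z) + (\<Sum>i<k. pf_coeff k x i * ((1 - z\<^sup>2) / (z - x i)))" .
  have "(\<Prod>i<Suc k. (t - x i) / (1 - x i * t)) / (1 - t) =
     ((\<Prod>i<k. (t - x i) / (1 - x i * t)) / (1 - t)) * ((t - z) / (1 - z * t))"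
    by (simp add: z_def)
  also have "\<dots> = (1 / (1 - t) + (\<Sum>i<k. pf_coeff k x i / (1 - x i * t))) * ((t - z) / (1 - z * t))"
    using Suc.prems by (subst Suc.IH[OF reg]) auto
  also have "\<dots> = 1 / (1 - t) * ((t - z) / (1 - z * t)) + (\<Sum>i<k. pf_coeff k x i / (1 - x i * t) * ((t - z) / (1 - z * t)))"
    by (simp only: distrib_right sum_distrib_right)
  also have "1 / (1 - t) * ((t - z) / (1 - z * t)) = 1 / (1 - t) - (1 + z) / (1 - z * t)"
    using nz(1,2) by (simp add: divide_simps) (simp add: algebra_simps)
  also have "(\<Sum>i<k. pf_coeff k x i / (1 - x i * t) * ((t - z) / (1 - z * t))) =
     (\<Sum>i<k. pf_coeff (Suc k) x i / (1 - x i * t) + pf_coeff k x i * ((1 - z\<^sup>2) / (z - x i)) / (1 - z * t))"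
  proof (rule sum.cong)
    fix i assume "i \<in> {..<k}"
    then have i: "i < k" by simp
    have "pf_coeff k x i / (1 - x i * t) * ((t - z) / (1 - z * t)) =
      pf_coeff k x i * (1 / (1 - x i * t) * ((t - z) / (1 - z * t)))"
      by simp
    \<comment> \<open>Partial fractions for two linear denominators: each constant is the remaining
      factor evaluated at the pole, \<open>1 / x i\<close> or \<open>1 / z\<close>.\<close>
    also have "1 / (1 - x i * t) * ((t - z) / (1 - z * t)) =
       (1 - x i * z) / (x i - z) / (1 - x i * t) + (1 - z\<^sup>2) / (z - x i) / (1 - z * t)"
      using nz(1) nz(4-6)[OF i] by (simp add: divide_simps) (simp add: power2_eq_square algebra_simps)
    finally show "pf_coeff k x i / (1 - x i * t) * ((t - z) / (1 - z * t)) =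
      pf_coeff (Suc k) x i / (1 - x i * t) + pf_coeff k x i * ((1 - z\<^sup>2) / (z - x i)) / (1 - z * t)"
      unfolding old[OF i] by (simp add: distrib_left)
  qed auto
  also have "1 / (1 - t) - (1 + z) / (1 - z * t) + \<dots> =
      1 / (1 - t) + (\<Sum>i<k. pf_coeff (Suc k) x i / (1 - x i * t)) + pf_coeff (Suc k) x k / (1 - z * t)"
    unfolding new by (simp add: sum.distrib add_divide_distrib sum_divide_distrib diff_divide_distrib)
  finally show ?case by (simp add: z_def)
qed auto

lemma prod_remove_skip:
  fixes f :: "nat \<Rightarrow> complex"
  assumes "i \<le> k"
  shows "(\<Prod>l\<in>{..<Suc k} - {i}. f l) = (\<Prod>l<k. f (skip i l))"
proof -
  have inj: "inj_on (skip i) {..<k}" by (auto simp: inj_on_def skip_def split: if_splits)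
  have im: "skip i ` {..<k} = {..<Suc k} - {i}"
  proof
    show "{..<Suc k} - {i} \<subseteq> skip i ` {..<k}"
    proof
      fix j assume j: "j \<in> {..<Suc k} - {i}"
      show "j \<in> skip i ` {..<k}"
        by (rule image_eqI[of _ _ "if j < i then j else j - 1"]) (use assms j in \<open>auto simp: skip_def\<close>)
    qed
  qed (use assms in \<open>auto simp: skip_def\<close>)
  show ?thesis
    using prod.reindex[OF inj, of f] by (simp add: im)
qed

lemma prod_insert_skip:
  fixes f :: "nat \<Rightarrow> complex"
  assumes "i \<le> k"
  shows "(\<Prod>l<Suc k. f l) = f i * (\<Prod>l<k. f (skip i l))"
  using assms prod.remove[of "{..<Suc k}" i f] prod_remove_skip[OF assms, of f] by simp

section \<open>Separating one variable from the kernel and integrating out the last one\<close>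

lemma kern_Suc: "kern (Suc k) x = kern k x * ((\<Prod>i<k. (x i - x k) / (x i * x k - 1)) / (x k - 1))"
  by (simp add: kern_def)

text \<open>Collects the factors of \<open>kern\<close> that contain \<open>x i\<close>. This
  variable stands second in the differences with earlier variables and first in those with later
  ones, whence the case distinction.\<close>

lemma kern_skip:
  assumes "i \<le> k"
  shows "kern (Suc k) x = kern k (x \<circ> skip i) / (x i - 1) *
     (\<Prod>l<k. (if l < i then x l - x i else x i - x (Suc l)) / (x (skip i l) * x i - 1))"
  using assms
proof (induction k)
  case 0
  then show ?case by (simp add: kern_def)
next
  case (Suc k)
  show ?case
  proof (cases "i = Suc k")
    case True
    define y where "y = x \<circ> skip i"
    have y: "kern (Suc k) y = kern (Suc k) x"
      using True by (intro kern_cong) (auto simp: skip_def y_def)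
    have Q: "(\<Prod>l<Suc k. (if l < i then x l - x i else x i - x (Suc l)) / (x (skip i l) * x i - 1)) =
       (\<Prod>l<Suc k. (x l - x i) / (x l * x i - 1))"
      using True by (intro prod.cong) (auto simp: skip_def)
    have "kern (Suc (Suc k)) x = kern (Suc k) x * ((\<Prod>l<Suc k. (x l - x i) / (x l * x i - 1)) / (x i - 1))"
      unfolding True by (rule kern_Suc)
    then show ?thesis unfolding Q y_def[symmetric] y
      by (simp only: times_divide_eq_right times_divide_eq_left)
  next
    case False
    with Suc have i: "i \<le> k" by simp
    define y where "y = x \<circ> skip i"
    have y: "x (skip i l) = y l" for l by (simp add: y_def)
    have sk: "x (Suc k) = y k" using i by (simp add: skip_def y_def)
    have alg: "a / b * p * ((c / d * q) / e) = a * (q / e) / b * (p * (c / d))" for a b c d e p q :: complex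
      by (simp add: mult_ac)
    have "kern (Suc (Suc k)) x = kern (Suc k) x * ((\<Prod>l<Suc k. (x l - y k) / (x l * y k - 1)) / (y k - 1))"
      unfolding sk[symmetric] by (rule kern_Suc)
    also have "(\<Prod>l<Suc k. (x l - y k) / (x l * y k - 1)) =
       (x i - y k) / (x i * y k - 1) * (\<Prod>l<k. (y l - y k) / (y l * y k - 1))"
      unfolding prod_insert_skip[OF i] y ..
    also have "kern (Suc k) x = kern k y / (x i - 1) *
     (\<Prod>l<k. (if l < i then x l - x i else x i - x (Suc l)) / (y l * x i - 1))"
      using Suc.IH i unfolding y y_def[symmetric] by simp
    finally show ?thesis
      unfolding y y_def[symmetric] kern_Suc[of k y] prod.lessThan_Suc alg
      using i sk by (simp add: mult.commute[of "x i" "y k"])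
  qed
qed

text \<open>The factors pairing \<open>x i\<close> with another variable cancel against those of
  \<open>pf_coeff\<close> up to sign; each of the \<open>k - i\<close> later variables leaves a -1.
  What remains of \<open>x i\<close> is a factor of its own, so its integral separates from the
  others.\<close>

lemma kern_pf_coeff:
  assumes reg: "regular (Suc k) x" and i: "i \<le> k"
  shows "kern (Suc k) x * pf_coeff (Suc k) x i = (-1) ^ (k - i) * ((1 + x i) / (1 - x i)) * kern k (x \<circ> skip i)"
proof -
  have nz: "x i \<noteq> x (skip i l)" "x i * x (skip i l) \<noteq> 1" if "l < k" for l
    using regular_distinct[OF reg, of i "skip i l"] i that by (auto simp: skip_def)
  have "(\<Prod>l<k. (if l < i then x l - x i else x i - x (Suc l)) / (x (skip i l) * x i - 1)) *
     (\<Prod>l<k. (1 - x i * x (skip i l)) / (x i - x (skip i l))) =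
     (\<Prod>l<k. if l < i then 1 else -1)"
    unfolding prod.distrib[symmetric]
  proof (rule prod.cong)
    fix l assume "l \<in> {..<k}"
    then have l: "x i - x (skip i l) \<noteq> 0" "x i * x (skip i l) - 1 \<noteq> 0" "x (skip i l) * x i - 1 \<noteq> 0"
      using nz[of l] by (auto simp: mult.commute)
    show "(if l < i then x l - x i else x i - x (Suc l)) / (x (skip i l) * x i - 1) *
      ((1 - x i * x (skip i l)) / (x i - x (skip i l))) = (if l < i then 1 else -1)"
      using l by (auto simp: skip_def divide_simps) (auto simp: algebra_simps)
  qed auto
  also have "(\<Prod>l<k. if l < i then 1 else -1 :: complex) = (-1) ^ (k - i)"
  proof -
    have "(\<Prod>l<k. if l < i then 1 else -1 :: complex) = (\<Prod>l\<in>{i..<k}. -1)"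
      by (rule prod.mono_neutral_cong_right) auto
    then show ?thesis by simp
  qed
  finally have *: "(\<Prod>l<k. (if l < i then x l - x i else x i - x (Suc l)) / (x (skip i l) * x i - 1)) *
     (\<Prod>l<k. (1 - x i * x (skip i l)) / (x i - x (skip i l))) = (-1) ^ (k - i)" .
  have alg: "c / (s - 1) * p * (- (1 + s) * q) = p * q * ((1 + s) / (1 - s)) * c"
    if "s \<noteq> 1" for c p q s :: complex
    using that by (simp add: divide_simps) (simp add: algebra_simps)
  have "x i \<noteq> 1" using reg i by (simp add: regular_def)
  then show ?thesis
    unfolding kern_skip[OF i] pf_coeff_def prod_remove_skip[OF i] *[symmetric] by (rule alg)
qed

abbreviation (input) two_pi_i :: complex where
  "two_pi_i \<equiv> 2 * complex_of_real pi * \<i>"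

text \<open>Expand the alternant along the last row, with signed minors \<open>c m\<close> free of
  \<open>t\<close>, and the kernel into partial fractions. The first sum in the value comes from the
  pole at 1, the second from the poles at \<open>inverse (x i)\<close>.\<close>

lemma has_contour_integral_alternant_kern_last:
  assumes r: "r > 0" and u: "\<And>m. m \<le> k \<Longrightarrow> u m > 0" and reg: "regular k x"
  defines "c \<equiv> \<lambda>m. (-1) ^ (k + m) * alternant k (u \<circ> skip m) x"
  shows "((\<lambda>t. alternant (Suc k) u (x(k := t)) * kern (Suc k) (x(k := t))) has_contour_integral
     two_pi_i * (kern k x * ((\<Sum>m\<le>k. c m) + (\<Sum>i<k. pf_coeff k x i * (\<Sum>m\<le>k. c m * x i powi (u m - 1)))))) (circlepath 0 r)"
proof (rule has_contour_integral_spike_circlepath)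
  define R where "R = (\<lambda>m t. t powi u m - t powi (- u m) :: complex)"
  have expand: "alternant (Suc k) u (x(k := t)) = (\<Sum>m\<le>k. c m * R m t)" for t
  proof -
    have "alternant k (u \<circ> skip m) (x(k := t) \<circ> skip k) = alternant k (u \<circ> skip m) x" for m
      by (rule alternant_cong) (auto simp: skip_def)
    then show ?thesis by (simp add: alternant_expand_row[of k k] c_def R_def mult_ac)
  qed
  \<comment> \<open>At \<open>t = x i\<close> two rows of the alternant coincide, and
    \<open>R m\<close> changes sign under inversion. So the expansion also vanishes at
    \<open>inverse (x i)\<close>, and its value there may be subtracted.\<close>
  have zero: "(\<Sum>m\<le>k. c m * R m (inverse (x i))) = 0" if "i < k" for i
  proof -
    have "(\<Sum>m\<le>k. c m * R m (x i)) = 0"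
      unfolding expand[symmetric] using that by (intro alternant_eq_0[of i _ k]) auto
    moreover have "R m (inverse (x i)) = - R m (x i)" for m
      by (simp add: R_def power_int_minus power_int_inverse)
    ultimately show ?thesis by (simp add: sum_negf)
  qed
  \<comment> \<open>After that subtraction each summand has only removable poles off 0, so the
    one-variable integrals apply term by term.\<close>
  define f where "f = (\<lambda>t. - kern k x * ((\<Sum>m\<le>k. c m * (R m t / (1 - t))) +
     (\<Sum>i<k. pf_coeff k x i * (\<Sum>m\<le>k. c m * ((R m t - R m (inverse (x i))) / (1 - x i * t))))))"
  have "(f has_contour_integral - kern k x * ((\<Sum>m\<le>k. c m * - two_pi_i) +
     (\<Sum>i<k. pf_coeff k x i * (\<Sum>m\<le>k. c m * - (x i powi (u m - 1) * two_pi_i))))) (circlepath 0 r)"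
    unfolding f_def R_def
    by (intro has_contour_integral_lmul has_contour_integral_add has_contour_integral_sum
        contour_integral_row_pole_one contour_integral_row_pole)
       (use r u reg in \<open>auto simp: regular_def\<close>)
  also have "- kern k x * ((\<Sum>m\<le>k. c m * - two_pi_i) +
     (\<Sum>i<k. pf_coeff k x i * (\<Sum>m\<le>k. c m * - (x i powi (u m - 1) * two_pi_i)))) =
     two_pi_i * (kern k x * ((\<Sum>m\<le>k. c m) + (\<Sum>i<k. pf_coeff k x i * (\<Sum>m\<le>k. c m * x i powi (u m - 1)))))"
    by (simp add: sum_negf sum_distrib_left algebra_simps)
  finally show "(f has_contour_integral two_pi_i * (kern k x * ((\<Sum>m\<le>k. c m) +
     (\<Sum>i<k. pf_coeff k x i * (\<Sum>m\<le>k. c m * x i powi (u m - 1)))))) (circlepath 0 r)" .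
  show "finite (insert 1 ((\<lambda>i. inverse (x i)) ` {..<k}))" by simp
  fix t :: complex assume t: "t \<noteq> 0" "t \<notin> insert 1 ((\<lambda>i. inverse (x i)) ` {..<k})"
  have t1: "x i * t \<noteq> 1" if "i < k" for i
    using t(2) that inverse_unique[of "x i" t] by auto
  have "kern (Suc k) (x(k := t)) = kern k x * ((\<Prod>i<k. (x i - t) / (x i * t - 1)) / (t - 1))"
  proof -
    have "kern k (x(k := t)) = kern k x" by (rule kern_cong) auto
    then show ?thesis unfolding kern_Suc by simp
  qed
  also have "(\<Prod>i<k. (x i - t) / (x i * t - 1)) = (\<Prod>i<k. (t - x i) / (1 - x i * t))"
    by (rule prod.cong) (metis minus_diff_eq minus_divide_divide, metis minus_diff_eq minus_divide_divide)
  also have "\<dots> / (t - 1) = - (\<dots> / (1 - t))"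
    by (metis minus_diff_eq divide_minus_right)
  also have "(\<Prod>i<k. (t - x i) / (1 - x i * t)) / (1 - t) = 1 / (1 - t) + (\<Sum>i<k. pf_coeff k x i / (1 - x i * t))"
    by (rule partial_fractions[OF reg]) (use t t1 in auto)
  finally have kern: "kern (Suc k) (x(k := t)) = - kern k x * (1 / (1 - t) + (\<Sum>i<k. pf_coeff k x i / (1 - x i * t)))"
    by (simp only: mult_minus_left mult_minus_right)
  have "(\<Sum>m\<le>k. c m * ((R m t - R m (inverse (x i))) / (1 - x i * t))) =
      (\<Sum>m\<le>k. c m * R m t) / (1 - x i * t)" if "i < k" for i
  proof -
    have "(\<Sum>m\<le>k. c m * ((R m t - R m (inverse (x i))) / (1 - x i * t))) =
       ((\<Sum>m\<le>k. c m * R m t) - (\<Sum>m\<le>k. c m * R m (inverse (x i)))) / (1 - x i * t)"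
      by (simp add: sum_divide_distrib sum_subtractf[symmetric] right_diff_distrib diff_divide_distrib)
    then show ?thesis using zero[OF that] by simp
  qed
  then have "f t = - kern k x * ((\<Sum>m\<le>k. c m * R m t) / (1 - t) +
     (\<Sum>i<k. pf_coeff k x i * ((\<Sum>m\<le>k. c m * R m t) / (1 - x i * t))))"
    unfolding f_def by (simp add: sum_divide_distrib)
  also have "\<dots> = (\<Sum>m\<le>k. c m * R m t) * (- kern k x * (1 / (1 - t) + (\<Sum>i<k. pf_coeff k x i / (1 - x i * t))))"
  proof -
    have "(\<Sum>i<k. pf_coeff k x i * (M / (1 - x i * t))) = M * (\<Sum>i<k. pf_coeff k x i / (1 - x i * t))" for M
      by (simp add: sum_distrib_left mult.commute)
    moreover have "- K * (M / a + M * S) = M * (- K * (1 / a + S))" for K M a S :: complex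
      by (simp add: algebra_simps)
    ultimately show ?thesis by (simp only:)
  qed
  finally show "f t = alternant (Suc k) u (x(k := t)) * kern (Suc k) (x(k := t))"
    unfolding expand kern .
qed (use r in auto)

text \<open>The signs of the pole at 1 and of the pairs add up to the factor that turns
  \<open>fact k\<close> into \<open>fact (k + 1)\<close>. Passing from \<open>k\<close> to
  \<open>k + 1\<close> replaces \<open>E\<close> by \<open>1 - E\<close> and \<open>D\<close> by
  \<open>D + E\<close>, so \<open>E + 2 * D\<close> grows by 1.\<close>

lemma alternating_sum_identity:
  "(\<Sum>m\<le>k. (-1) ^ (k + m)) + 2 * (\<Sum>m\<le>k. \<Sum>l<k. if m \<le> l then (-1) ^ (m + l) else 0) = (of_nat (k + 1) :: complex)"
proof (induction k)
  case (Suc k)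
  define E where "E = (\<Sum>m\<le>k. (-1) ^ (k + m) :: complex)"
  define D where "D = (\<Sum>m\<le>k. \<Sum>l<k. if m \<le> l then (-1) ^ (m + l) else 0 :: complex)"
  have A: "(\<Sum>m\<le>Suc k. (-1) ^ (Suc k + m) :: complex) = 1 - E"
    by (simp add: E_def sum_negf flip: power_add mult_2)
  have B: "(\<Sum>m\<le>Suc k. \<Sum>l<Suc k. if m \<le> l then (-1) ^ (m + l) else 0 :: complex) = D + E"
    by (simp add: D_def E_def sum.distrib add.commute)
  show ?case using Suc unfolding A B E_def[symmetric] D_def[symmetric]
    by (simp add: algebra_simps)
qed auto

text \<open>
  The sum over \<open>m\<close> vanishes when \<open>x i powi u m\<close> is replaced by \<open>x i powi u m - x i powi (- u m)\<close>,
  because the determinant it expands then has two equal rows. Averaging over the two signs of the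
  exponent makes every summand on the right a Laurent polynomial in \<open>x i\<close>.
\<close>

lemma kern_pf_coeff_alternant:
  assumes reg: "regular (Suc k) x" and i: "i \<le> k"
  shows "kern (Suc k) x * (pf_coeff (Suc k) x i *
      (\<Sum>m\<le>Suc k. (-1) ^ (Suc k + m) * alternant (Suc k) (u \<circ> skip m) x * x i powi (u m - 1))) =
    (\<Sum>m\<le>Suc k. \<Sum>l\<le>k. - ((-1) ^ (m + l) / 2) *
      (((x i powi u m + x i powi (- u m)) * (x i powi u (skip m l) - x i powi (- u (skip m l))) * ((1 + x i) / (1 - x i)) / x i) *
       (alternant k (u \<circ> skip m \<circ> skip l) (x \<circ> skip i) * kern k (x \<circ> skip i))))"
proof -
  define c where "c = (\<lambda>m. (-1) ^ (Suc k + m) * alternant (Suc k) (u \<circ> skip m) x)"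
  define s where "s = x i"
  have s: "s \<noteq> 0" "s \<noteq> 1" using reg i by (auto simp: regular_def s_def)
  have "(\<Sum>m\<le>Suc k. c m * (s powi u m - s powi (- u m))) = 0"
  proof -
    have "(\<Sum>m\<le>Suc k. c m * (s powi u m - s powi (- u m))) = alternant (Suc (Suc k)) u (x(Suc k := s))"
    proof -
      have "alternant (Suc k) (u \<circ> skip m) (x(Suc k := s) \<circ> skip (Suc k)) = alternant (Suc k) (u \<circ> skip m) x" for m
        by (rule alternant_cong) (auto simp: skip_def)
      then show ?thesis by (simp add: alternant_expand_row[of "Suc k" "Suc k"] c_def mult_ac)
    qed
    also have "\<dots> = 0"
      using i by (intro alternant_eq_0[of i _ "Suc k"]) (auto simp: s_def)
    finally show ?thesis .
  qed
  then have "(\<Sum>m\<le>Suc k. c m * (2 * s powi u m)) = (\<Sum>m\<le>Suc k. c m * (2 * s powi u m)) - (\<Sum>m\<le>Suc k. c m * (s powi u m - s powi (- u m)))"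
    by simp
  also have "\<dots> = (\<Sum>m\<le>Suc k. c m * (s powi u m + s powi (- u m)))"
    by (simp only: sum_subtractf[symmetric]) (simp add: algebra_simps)
  finally have double: "(\<Sum>m\<le>Suc k. c m * (2 * s powi u m)) = (\<Sum>m\<le>Suc k. c m * (s powi u m + s powi (- u m)))" .
  have sym: "(\<Sum>m\<le>Suc k. c m * s powi (u m - 1)) = (\<Sum>m\<le>Suc k. c m * ((s powi u m + s powi (- u m)) / (2 * s)))"
  proof -
    have "(\<Sum>m\<le>Suc k. c m * s powi (u m - 1)) = (\<Sum>m\<le>Suc k. c m * (2 * s powi u m)) / (2 * s)"
      unfolding sum_divide_distrib using s by (intro sum.cong) (auto simp: power_int_diff)
    also have "\<dots> = (\<Sum>m\<le>Suc k. c m * (s powi u m + s powi (- u m))) / (2 * s)"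
      unfolding double ..
    finally show ?thesis by (simp only: sum_divide_distrib times_divide_eq_right)
  qed
  \<comment> \<open>A second Laplace expansion, now along the row of \<open>x i\<close>, leaves
    minors that are free of \<open>x i\<close> and have two columns deleted.\<close>
  have c: "c m = (\<Sum>l\<le>k. (-1) ^ (Suc k + m + i + l) * (s powi u (skip m l) - s powi (- u (skip m l))) * alternant k (u \<circ> skip m \<circ> skip l) (x \<circ> skip i))" for m
    unfolding c_def alternant_expand_row[OF i] s_def
    by (simp add: sum_distrib_left power_add mult_ac)
  have "kern (Suc k) x * (pf_coeff (Suc k) x i * (\<Sum>m\<le>Suc k. c m * s powi (u m - 1))) =
     (-1) ^ (k - i) * ((1 + s) / (1 - s)) * kern k (x \<circ> skip i) * (\<Sum>m\<le>Suc k. c m * ((s powi u m + s powi (- u m)) / (2 * s)))"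
    unfolding sym kern_pf_coeff[OF reg i, folded s_def, symmetric] by (simp only: mult.assoc)
  also have "\<dots> = (\<Sum>m\<le>Suc k. \<Sum>l\<le>k. - ((-1) ^ (m + l) / 2) *
      (((s powi u m + s powi (- u m)) * (s powi u (skip m l) - s powi (- u (skip m l))) * ((1 + s) / (1 - s)) / s) *
       (alternant k (u \<circ> skip m \<circ> skip l) (x \<circ> skip i) * kern k (x \<circ> skip i))))"
    unfolding c sum_distrib_left sum_distrib_right
  proof (intro sum.cong refl)
    have alg: "e * W * K * (p * Y * L * (Z / (2 * s))) = - (q / 2) * ((Z * Y * W / s) * (L * K))"
      if "e * p = - q" for e W K p Y L Z q :: complex
    proof -
      have "e * W * K * (p * Y * L * (Z / (2 * s))) = (e * p) * (W * K * Y * L * Z / (2 * s))"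
        by (simp add: mult_ac)
      then show ?thesis unfolding that by (simp add: mult_ac)
    qed
    fix m l
    have "(-1) ^ (k - i) * (-1) ^ (Suc k + m + i + l) = (- ((-1) ^ (m + l)) :: complex)"
    proof -
      have "k - i + (Suc k + m + i + l) = 2 * k + Suc (m + l)" using i by simp
      then show ?thesis by (simp add: power_add[symmetric] del: add_Suc) (simp add: power_add power_mult)
    qed
    then show "(-1) ^ (k - i) * ((1 + s) / (1 - s)) * kern k (x \<circ> skip i) *
       ((-1) ^ (Suc k + m + i + l) * (s powi u (skip m l) - s powi (- u (skip m l))) * alternant k (u \<circ> skip m \<circ> skip l) (x \<circ> skip i) *
        ((s powi u m + s powi (- u m)) / (2 * s))) =
      - ((-1) ^ (m + l) / 2) *
      (((s powi u m + s powi (- u m)) * (s powi u (skip m l) - s powi (- u (skip m l))) * ((1 + s) / (1 - s)) / s) *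
       (alternant k (u \<circ> skip m \<circ> skip l) (x \<circ> skip i) * kern k (x \<circ> skip i)))"
      by (rule alg)
  qed
  finally show ?thesis unfolding c_def s_def .
qed

section \<open>Evaluation of the integral by induction on the number of variables\<close>

lemma has_torus_integral_alternant_kern:
  assumes "r > 0" "\<And>m. m < k \<Longrightarrow> u m > 0" "\<And>l m. l < m \<Longrightarrow> m < k \<Longrightarrow> u l < u m"
  shows "has_torus_integral r k (\<lambda>x. alternant k u x * kern k x) (two_pi_i ^ k * fact k)"
  using assms(2,3)
\<comment> \<open>Strong induction, since the pole at 1 removes one variable and the other poles
  remove two. The value is independent of \<open>u\<close>, so all minors of the same size have the
  same integral.\<close>
proof (induction k arbitrary: u rule: less_induct)
  case (less k)
  show ?case
  proof (cases k)
    case 0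
    then show ?thesis by (simp add: alternant_def kern_def)
  next
    case (Suc k')
    have sub: "has_torus_integral r k' (\<lambda>x. alternant k' (u \<circ> skip m) x * kern k' x) (two_pi_i ^ k' * fact k')" if "m \<le> k'" for m
      using less.prems Suc that by (intro less.IH) (auto simp: skip_def)
    \<comment> \<open>\<open>g i\<close> is what the pole at \<open>inverse (x i)\<close>
      contributes, up to the factor \<open>2 * pi * i\<close>, once the last variable is integrated
      out. Its own integral turns out not to depend on \<open>i\<close>.\<close>
    define g where "g = (\<lambda>i x. kern k' x * (pf_coeff k' x i *
      (\<Sum>m\<le>k'. (-1) ^ (k' + m) * alternant k' (u \<circ> skip m) x * x i powi (u m - 1))))"
    define d where "d = (\<Sum>m\<le>k'. \<Sum>l<k'. if m \<le> l then (-1) ^ (m + l) else 0 :: complex)"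
    have g: "has_torus_integral r k' (g i) (2 * two_pi_i ^ k' * fact (k' - 1) * d)" if ik: "i < k'" for i
    proof -
      obtain j where j: "k' = Suc j" using ik by (cases k') auto
      have ij: "i \<le> j" using ik j by simp
      have "has_torus_integral r (Suc j)
        (\<lambda>x. \<Sum>m\<le>Suc j. \<Sum>l\<le>j. - ((-1) ^ (m + l) / 2) *
      (((x i powi u m + x i powi (- u m)) * (x i powi u (skip m l) - x i powi (- u (skip m l))) * ((1 + x i) / (1 - x i)) / x i) *
       (alternant j (u \<circ> skip m \<circ> skip l) (x \<circ> skip i) * kern j (x \<circ> skip i))))
        (\<Sum>m\<le>Suc j. \<Sum>l\<le>j. - ((-1) ^ (m + l) / 2) * ((if u m < u (skip m l) then - 4 * two_pi_i else 0) * (two_pi_i ^ j * fact j)))"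
      proof (intro has_torus_integral_sum has_torus_integral_cmult finite_atMost)
        fix m l assume m: "m \<in> {..Suc j}" and l: "l \<in> {..j}"
        have "has_torus_integral r j (\<lambda>x. alternant j (u \<circ> skip m \<circ> skip l) x * kern j x) (two_pi_i ^ j * fact j)"
          using less.prems Suc j m l by (intro less.IH) (auto simp: skip_def)
        moreover have "u m \<noteq> u (skip m l)"
          using less.prems(2)[of m "skip m l"] less.prems(2)[of "skip m l" m] Suc j m l by (auto simp: skip_def split: if_splits)
        moreover have "u m > 0" "u (skip m l) > 0"
          using less.prems(1) Suc j m l by (auto simp: skip_def)
        ultimately show "has_torus_integral r (Suc j) (\<lambda>x.
          ((x i powi u m + x i powi (- u m)) * (x i powi u (skip m l) - x i powi (- u (skip m l))) * ((1 + x i) / (1 - x i)) / x i) *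
          (alternant j (u \<circ> skip m \<circ> skip l) (x \<circ> skip i) * kern j (x \<circ> skip i)))
          ((if u m < u (skip m l) then - 4 * two_pi_i else 0) * (two_pi_i ^ j * fact j))"
          using assms(1) ij contour_integral_row_pair[of r "u m" "u (skip m l)"]
          by (intro has_torus_integral_prod[where h = "\<lambda>y. alternant j (u \<circ> skip m \<circ> skip l) y * kern j y" and
              g = "\<lambda>s. (s powi u m + s powi (- u m)) * (s powi u (skip m l) - s powi (- u (skip m l))) * ((1 + s) / (1 - s)) / s"]) auto
      qed
      also have "(\<Sum>m\<le>Suc j. \<Sum>l\<le>j. - ((-1) ^ (m + l) / 2) * ((if u m < u (skip m l) then - 4 * two_pi_i else 0) * (two_pi_i ^ j * fact j))) =
         (\<Sum>m\<le>Suc j. \<Sum>l\<le>j. 2 * two_pi_i ^ k' * fact j * (if m \<le> l then (-1) ^ (m + l) else 0))"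
      proof (intro sum.cong refl)
        fix m l assume m: "m \<in> {..Suc j}" and l: "l \<in> {..j}"
        \<comment> \<open>Since \<open>u\<close> increases, this compares indices, and
          \<open>skip m l\<close> exceeds \<open>m\<close> exactly when \<open>l\<close> is not
          below \<open>m\<close>.\<close>
        have "u m < u (skip m l) \<longleftrightarrow> m \<le> l"
          using less.prems(2)[of m "skip m l"] less.prems(2)[of "skip m l" m] Suc j m l by (auto simp: skip_def split: if_splits)
        then show "- ((-1) ^ (m + l) / 2) * ((if u m < u (skip m l) then - 4 * two_pi_i else 0) * (two_pi_i ^ j * fact j)) =
           2 * two_pi_i ^ k' * fact j * (if m \<le> l then (-1) ^ (m + l) else 0)"
          by (simp add: j algebra_simps)
      qed
      also have "\<dots> = 2 * two_pi_i ^ k' * fact (k' - 1) * d"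
        by (simp add: d_def j sum_distrib_left lessThan_Suc_atMost del: sum.atMost_Suc)
      also note integral = calculation[folded j]
      show ?thesis
      proof (rule has_torus_integral_cong[OF integral])
        show "generic k' (\<lambda>x. (\<Sum>m\<le>k'. \<Sum>l\<le>j. - ((-1) ^ (m + l) / 2) *
      (((x i powi u m + x i powi (- u m)) * (x i powi u (skip m l) - x i powi (- u (skip m l))) * ((1 + x i) / (1 - x i)) / x i) *
       (alternant j (u \<circ> skip m \<circ> skip l) (x \<circ> skip i) * kern j (x \<circ> skip i)))) = g i x)"
          unfolding g_def
          by (rule generic_mono[OF generic_regular]) (rule kern_pf_coeff_alternant[OF _ ij, folded j, symmetric])
      qed
    qed
    have "has_torus_integral r k' (\<lambda>x. two_pi_i * ((\<Sum>m\<le>k'. (-1) ^ (k' + m) * (alternant k' (u \<circ> skip m) x * kern k' x)) + (\<Sum>i<k'. g i x)))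
       (two_pi_i * ((\<Sum>m\<le>k'. (-1) ^ (k' + m) * (two_pi_i ^ k' * fact k')) + (\<Sum>i<k'. 2 * two_pi_i ^ k' * fact (k' - 1) * d)))"
      by (intro has_torus_integral_cmult has_torus_integral_add has_torus_integral_sum sub g) auto
    also have "(\<Sum>m\<le>k'. (-1) ^ (k' + m) * (two_pi_i ^ k' * fact k')) + (\<Sum>i<k'. 2 * two_pi_i ^ k' * fact (k' - 1) * d) =
       two_pi_i ^ k' * fact k' * ((\<Sum>m\<le>k'. (-1) ^ (k' + m)) + 2 * d)"
    proof -
      \<comment> \<open>For \<open>k' = 0\<close>, where \<open>k' - 1\<close> is truncated, both
        sides vanish because \<open>d\<close> is 0.\<close>
      have fact: "of_nat k' * fact (k' - 1) * d = fact k' * d"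
        by (cases k') (auto simp: d_def)
      have "(\<Sum>i<k'. 2 * p * fact (k' - 1) * d) = p * fact k' * (2 * d)" for p
      proof -
        have "(\<Sum>i<k'. 2 * p * fact (k' - 1) * d) = 2 * p * (of_nat k' * fact (k' - 1) * d)"
          by (simp add: mult_ac)
        then show ?thesis unfolding fact by (simp add: mult_ac)
      qed
      moreover have "(\<Sum>m\<le>k'. (-1) ^ (k' + m) * (p * fact k')) = p * fact k' * (\<Sum>m\<le>k'. (-1) ^ (k' + m))" for p :: complex
        by (simp add: sum_distrib_left mult.commute)
      ultimately show ?thesis by (simp only: distrib_left)
    qed
    also have "(\<Sum>m\<le>k'. (-1) ^ (k' + m)) + 2 * d = of_nat (k' + 1)"
      unfolding d_def by (rule alternating_sum_identity)
    also have "two_pi_i * (two_pi_i ^ k' * fact k' * of_nat (k' + 1)) = two_pi_i ^ k * fact k"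
      by (simp add: Suc algebra_simps)
    finally have "has_torus_integral r (Suc k') (\<lambda>x. alternant (Suc k') u x * kern (Suc k') x) (two_pi_i ^ k * fact k)"
    proof (rule has_torus_integral_last)
      show "generic k' (\<lambda>x. ((\<lambda>t. alternant (Suc k') u (x(k' := t)) * kern (Suc k') (x(k' := t))) has_contour_integral
         two_pi_i * ((\<Sum>m\<le>k'. (-1) ^ (k' + m) * (alternant k' (u \<circ> skip m) x * kern k' x)) + (\<Sum>i<k'. g i x))) (circlepath 0 r))"
      proof (rule generic_mono[OF generic_regular])
        fix x assume reg: "regular k' x"
        have "two_pi_i * ((\<Sum>m\<le>k'. (-1) ^ (k' + m) * (alternant k' (u \<circ> skip m) x * kern k' x)) + (\<Sum>i<k'. g i x)) =
          two_pi_i * (kern k' x * ((\<Sum>m\<le>k'. (-1) ^ (k' + m) * alternant k' (u \<circ> skip m) x) +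
            (\<Sum>i<k'. pf_coeff k' x i * (\<Sum>m\<le>k'. (-1) ^ (k' + m) * alternant k' (u \<circ> skip m) x * x i powi (u m - 1)))))"
          by (simp add: g_def distrib_left sum_distrib_left mult_ac)
        then show "((\<lambda>t. alternant (Suc k') u (x(k' := t)) * kern (Suc k') (x(k' := t))) has_contour_integral
         two_pi_i * ((\<Sum>m\<le>k'. (-1) ^ (k' + m) * (alternant k' (u \<circ> skip m) x * kern k' x)) + (\<Sum>i<k'. g i x))) (circlepath 0 r)"
          using has_contour_integral_alternant_kern_last[OF assms(1) _ reg, of u] less.prems(1) Suc by simp
      qed
    qed
    then show ?thesis unfolding Suc .
  qed
qed

subsection \<open>Vandermonde and symplectic denominators\<close>

text \<open>The matrix is the Vandermonde matrix times the matrix of coefficients, which is upper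
  triangular with ones on the diagonal.\<close>

lemma det_of_monic_polys:
  assumes "\<And>m. m < k \<Longrightarrow> degree (p m) \<le> m" "\<And>m. m < k \<Longrightarrow> coeff (p m) m = 1"
  shows "det_of k (\<lambda>j m. poly (p m) (y j)) = det_of k (\<lambda>j m. y j ^ m)"
proof -
  let ?V = "Matrix.mat k k (\<lambda>(j, m). y j ^ m)"
  let ?C = "Matrix.mat k k (\<lambda>(i, m). coeff (p m) i)"
  have "Matrix.mat k k (\<lambda>(j, m). poly (p m) (y j)) = ?V * ?C"
  proof (rule eq_matI)
    fix j m assume jm: "j < dim_row (?V * ?C)" "m < dim_col (?V * ?C)"
    have "poly (p m) (y j) = (\<Sum>i\<le>degree (p m). coeff (p m) i * y j ^ i)"
      by (rule poly_altdef)
    also have "\<dots> = (\<Sum>i = 0..<k. y j ^ i * coeff (p m) i)"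
      using jm assms(1)[of m]
      by (intro sum.mono_neutral_cong_left) (auto simp: coeff_eq_0 mult.commute)
    finally show "Matrix.mat k k (\<lambda>(j, m). poly (p m) (y j)) $$ (j, m) = (?V * ?C) $$ (j, m)"
      using jm by (simp add: scalar_prod_def)
  qed auto
  then have "det_of k (\<lambda>j m. poly (p m) (y j)) = det ?V * det ?C"
    by (simp add: det_mult[of _ k])
  also have "det ?C = prod_list (diag_mat ?C)"
  proof (rule det_upper_triangular[of _ k])
    have "coeff (p m) i = 0" if "m < i" "m < k" for i m
      using assms(1)[of m] that by (intro coeff_eq_0) auto
    then show "upper_triangular ?C" by (auto simp: upper_triangular_def)
  qed auto
  also have "\<dots> = (\<Prod>i = 0..<k. ?C $$ (i, i))"
    by (simp add: prod_list_diag_prod)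
  also have "\<dots> = 1"
    by (rule prod.neutral) (use assms(2) in auto)
  finally show ?thesis by simp
qed

lemma det_of_vandermonde:
  "det_of k (\<lambda>j m. y j ^ m) = (\<Prod>j<k. \<Prod>i<j. y j - y i)"
proof -
  \<comment> \<open>The Newton basis: \<open>p m\<close> vanishes at \<open>y j\<close> for
    \<open>j < m\<close>, which makes the matrix of values lower triangular.\<close>
  define p where "p = (\<lambda>m. \<Prod>l<m. [:- y l, 1:])"
  have p: "degree (p m) \<le> m \<and> coeff (p m) m = 1" for m
  proof (induction m)
    case (Suc m)
    then have "coeff (p m) (Suc m) = 0" by (intro coeff_eq_0) auto
    moreover have "degree (p (Suc m)) \<le> Suc m"
      unfolding p_def prod.lessThan_Suc
      using Suc degree_mult_le[of "p m" "[:- y m, 1:]"] by (simp add: p_def)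
    ultimately show ?case using Suc by (simp add: p_def mult.commute)
  qed (simp add: p_def)
  have "det_of k (\<lambda>j m. y j ^ m) = det_of k (\<lambda>j m. poly (p m) (y j))"
    using p by (intro det_of_monic_polys[symmetric]) auto
  also have "\<dots> = prod_list (diag_mat (Matrix.mat k k (\<lambda>(j, m). poly (p m) (y j))))"
    by (rule det_lower_triangular[of k]) (auto simp: p_def poly_prod)
  also have "\<dots> = (\<Prod>j = 0..<k. \<Prod>i<j. y j - y i)"
    by (auto simp: prod_list_diag_prod p_def poly_prod intro!: prod.cong)
  finally show ?thesis by (simp add: atLeast0LessThan)
qed

lemma det_of_scale_rows:
  "det_of k (\<lambda>j m. d j * f j m) = (\<Prod>j<k. d j) * det_of k f"
proof -
  have "det_of k (\<lambda>j m. d j * f j m) =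
     (\<Sum>p | p permutes {0..<k}. signof p * (\<Prod>i = 0..<k. d i * f i (p i)))"
    by (subst det_def'[of _ k]) (auto intro!: sum.cong prod.cong simp: permutes_in_image)
  also have "\<dots> = (\<Prod>j<k. d j) * (\<Sum>p | p permutes {0..<k}. signof p * (\<Prod>i = 0..<k. f i (p i)))"
    by (simp add: prod.distrib sum_distrib_left atLeast0LessThan mult_ac)
  also have "(\<Sum>p | p permutes {0..<k}. signof p * (\<Prod>i = 0..<k. f i (p i))) = det_of k f"
    by (subst det_def'[of _ k]) (auto intro!: sum.cong prod.cong simp: permutes_in_image)
  finally show ?thesis .
qed

text \<open>Chebyshev polynomials of the second kind, with the variable halved to make them
  monic.\<close>

fun cheb :: "nat \<Rightarrow> complex poly" where
  "cheb 0 = 1"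
| "cheb (Suc 0) = [:0, 1:]"
| "cheb (Suc (Suc m)) = pCons 0 (cheb (Suc m)) - cheb m"

lemma degree_cheb: "degree (cheb m) \<le> m" and coeff_cheb: "coeff (cheb m) m = 1"
proof -
  have "degree (cheb m) \<le> m \<and> coeff (cheb m) m = 1"
  proof (induction m rule: cheb.induct)
    case (3 m)
    then have "coeff (cheb m) (Suc (Suc m)) = 0" by (intro coeff_eq_0) auto
    moreover have "degree (cheb (Suc (Suc m))) \<le> Suc (Suc m)"
      unfolding cheb.simps using 3 by (intro degree_diff_le) (auto intro: order_trans[OF degree_pCons_le])
    ultimately show ?case using 3 by simp
  qed auto
  then show "degree (cheb m) \<le> m" "coeff (cheb m) m = 1" by auto
qed

lemma powi_neg_Suc: "(x :: complex) powi (- int (n + 1)) = (1 / x) ^ (n + 1)"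
  by (simp only: power_int_minus power_int_of_nat power_one_over inverse_eq_divide)

lemma poly_cheb:
  assumes "x \<noteq> 0"
  shows "(x - 1 / x) * poly (cheb m) (x + 1 / x) = x ^ (m + 1) - x powi (- int (m + 1))"
proof -

  \<comment> \<open>Replacing \<open>1 / x\<close> by any \<open>y\<close> with
    \<open>x * y = 1\<close> keeps the recurrence free of division.\<close>
  have "(x - y) * poly (cheb m) (x + y) = x ^ (m + 1) - y ^ (m + 1)" if "x * y = 1" for y
  proof (induction m rule: cheb.induct)
    case (3 m)
    have "x * (y * z) = z" "y * (x * z) = z" for z using that by (metis mult.assoc mult_1 mult.commute)+
    have "(x - y) * poly (cheb (Suc (Suc m))) (x + y) =
       (x + y) * ((x - y) * poly (cheb (Suc m)) (x + y)) - (x - y) * poly (cheb m) (x + y)"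
      by (simp add: algebra_simps)
    also have "\<dots> = (x + y) * (x ^ (m + 2) - y ^ (m + 2)) - (x ^ (m + 1) - y ^ (m + 1))"
      using 3 by simp
    also have "\<dots> = x ^ (m + 3) - y ^ (m + 3) + (x * y - 1) * (x ^ (m + 1) - y ^ (m + 1))"
      by (simp add: algebra_simps power_add power2_eq_square power3_eq_cube)
    finally show ?case using that by (simp add: numeral_3_eq_3)
  qed (auto simp: power2_eq_square algebra_simps)
  from this[of "1 / x"] show ?thesis using assms unfolding powi_neg_Suc by simp
qed

text \<open>Once \<open>x j - 1 / x j\<close> is taken out of each row, the entries are monic
  polynomials in \<open>x j + 1 / x j\<close>, which leaves a Vandermonde determinant in these
  quantities.\<close>

lemma det_of_symplectic_denominator:
  assumes "\<And>j. j < k \<Longrightarrow> x j \<noteq> 0"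
  shows "det_of k (\<lambda>j m. x j ^ (m + 1) - x j powi (- int (m + 1))) =
    (\<Prod>j<k. (x j - 1 / x j) * (\<Prod>i<j. (x j + 1 / x j) - (x i + 1 / x i)))"
proof -
  have "det_of k (\<lambda>j m. x j ^ (m + 1) - x j powi (- int (m + 1))) =
     det_of k (\<lambda>j m. (x j - 1 / x j) * poly (cheb m) (x j + 1 / x j))"
    by (rule arg_cong[where f = det], rule cong_mat) (use assms poly_cheb in auto)
  also have "\<dots> = (\<Prod>j<k. x j - 1 / x j) * (\<Prod>j<k. \<Prod>i<j. (x j + 1 / x j) - (x i + 1 / x i))"
    unfolding det_of_scale_rows det_of_monic_polys[of k cheb, OF degree_cheb coeff_cheb] det_of_vandermonde ..
  finally show ?thesis by (simp add: prod.distrib)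
qed

text \<open>At a regular point the symplectic denominator is nonzero. Factors are matched pair by
  pair through \<open>d\<close> and variable by variable through \<open>e\<close>, where
  \<open>(x j + 1) / x j\<close> over \<open>x j - 1 / x j\<close> leaves
  \<open>1 / (x j - 1)\<close>.\<close>

lemma integrand_eq_kern:
  assumes reg: "regular k x"
  shows "det_of k (\<lambda>j m. x j ^ (m + 1)) * det_of k (\<lambda>j m. x j powi (- int (m + 1))) *
      (a / det_of k (\<lambda>j m. x j ^ (m + 1) - x j powi (- int (m + 1)))) * s * (\<Prod>j<k. (x j + 1) / x j) =
    a * kern k x * s"
proof -
  have nz: "x j \<noteq> 0" "x j \<noteq> 1" "x j \<noteq> -1" if "j < k" for j
    using reg that by (auto simp: regular_def)
  have nz2: "x i \<noteq> x j" "x i * x j \<noteq> 1" if "i < j" "j < k" for i j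
    using reg that by (auto simp: regular_def)
  have 1: "det_of k (\<lambda>j m. x j ^ (m + 1)) = (\<Prod>j<k. x j) * (\<Prod>j<k. \<Prod>i<j. x j - x i)"
    using det_of_scale_rows[of k x "\<lambda>j m. x j ^ m"] by (simp add: det_of_vandermonde)
  have "det_of k (\<lambda>j m. x j powi (- int (m + 1))) = det_of k (\<lambda>j m. (1 / x j) * (1 / x j) ^ m)"
    unfolding powi_neg_Suc by simp
  then have 2: "det_of k (\<lambda>j m. x j powi (- int (m + 1))) = (\<Prod>j<k. 1 / x j) * (\<Prod>j<k. \<Prod>i<j. 1 / x j - 1 / x i)"
    unfolding det_of_scale_rows det_of_vandermonde .
  have d: "x j + 1 / x j - (x i + 1 / x i) = (x j - x i) * (x i * x j - 1) / (x i * x j)" if "i < j" "j < k" for i j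
    using nz[of i] nz[of j] that by (simp add: divide_simps) (simp add: algebra_simps)
  have e: "x j - 1 / x j = (x j - 1) * (x j + 1) / x j" if "j < k" for j
    using nz[of j] that by (simp add: divide_simps) (simp add: algebra_simps)
  let ?D = "det_of k (\<lambda>j m. x j ^ (m + 1) - x j powi (- int (m + 1)))"
  have D: "?D = (\<Prod>j<k. (x j - 1 / x j) * (\<Prod>i<j. (x j + 1 / x j) - (x i + 1 / x i)))"
    by (rule det_of_symplectic_denominator) (use nz in auto)
  have "?D \<noteq> 0"
  proof -
    have "x j - 1 / x j \<noteq> 0" if "j < k" for j
      unfolding e[OF that] using nz[OF that] by (simp flip: eq_neg_iff_add_eq_0)
    moreover have "x j + 1 / x j - (x i + 1 / x i) \<noteq> 0" if "i < j" "j < k" for i j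
      unfolding d[OF that] using nz2[OF that] nz(1)[of i] nz(1)[of j] that by simp
    ultimately show ?thesis unfolding D by (auto simp del: right_minus_eq)
  qed
  have "kern k x * ?D = (\<Prod>j<k. ((\<Prod>i<j. (x i - x j) / (x i * x j - 1)) / (x j - 1)) *
       ((x j - 1 / x j) * (\<Prod>i<j. (x j + 1 / x j) - (x i + 1 / x i))))"
    unfolding D kern_def by (rule prod.distrib[symmetric])
  also have "\<dots> = (\<Prod>j<k. x j * (\<Prod>i<j. x j - x i) * (1 / x j * (\<Prod>i<j. 1 / x j - 1 / x i)) * ((x j + 1) / x j))"
  proof (rule prod.cong)
    fix j assume "j \<in> {..<k}"
    then have j: "j < k" by simp
    have "(\<Prod>i<j. (x i - x j) / (x i * x j - 1)) * (\<Prod>i<j. (x j + 1 / x j) - (x i + 1 / x i)) =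
       (\<Prod>i<j. x j - x i) * (\<Prod>i<j. 1 / x j - 1 / x i)"
      unfolding prod.distrib[symmetric]
    proof (rule prod.cong)
      fix i assume "i \<in> {..<j}"
      then have i: "i < j" by simp
      show "(x i - x j) / (x i * x j - 1) * ((x j + 1 / x j) - (x i + 1 / x i)) = (x j - x i) * (1 / x j - 1 / x i)"
      proof -
        have "1 / x j - 1 / x i = (x i - x j) / (x i * x j)"
          using nz(1)[of i] nz(1)[of j] i j by (simp add: field_simps)
        then show ?thesis
          unfolding d[OF i j] using nz2(2)[OF i j] by simp
      qed
    qed auto
    moreover have "a / (x j - 1) * ((x j - 1 / x j) * b) = x j * c * (1 / x j * d) * ((x j + 1) / x j)"
      if "a * b = c * d" for a b c d
    proof -
      have "a / (x j - 1) * ((x j - 1 / x j) * b) = (a * b) * ((x j - 1 / x j) / (x j - 1))"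
        by simp
      also have "(x j - 1 / x j) / (x j - 1) = (x j + 1) / x j"
        unfolding e[OF j] using nz[OF j] by simp
      finally show ?thesis unfolding that using nz[OF j] by simp
    qed
    ultimately show "(\<Prod>i<j. (x i - x j) / (x i * x j - 1)) / (x j - 1) * ((x j - 1 / x j) * (\<Prod>i<j. (x j + 1 / x j) - (x i + 1 / x i))) =
       x j * (\<Prod>i<j. x j - x i) * (1 / x j * (\<Prod>i<j. 1 / x j - 1 / x i)) * ((x j + 1) / x j)"
      by blast
  qed auto
  also have "\<dots> = det_of k (\<lambda>j m. x j ^ (m + 1)) * det_of k (\<lambda>j m. x j powi (- int (m + 1))) * (\<Prod>j<k. (x j + 1) / x j)"
    unfolding 1 2 by (simp only: prod.distrib mult_ac)
  finally have *: "kern k x * ?D = \<dots>" .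
  have alg: "p * q * (a / d) * s * t = a * c * s" if "c * d = p * q * t" "d \<noteq> 0" for p q d t c :: complex
  proof -
    have "p * q * (a / d) * s * t = (p * q * t) * (a * s / d)" by simp
    also have "\<dots> = c * d * (a * s / d)"
      unfolding that(1) ..
    also have "\<dots> = a * c * s"
      using that(2) by simp
    finally show ?thesis .
  qed
  show ?thesis by (rule alg[OF * \<open>?D \<noteq> 0\<close>])
qed

subsection \<open>The reflection principle\<close>

lemma reflection_swap:
  assumes "i < j" "j < k" "x \<in> carrier_vec k" "l < k"
  shows "reflection (unit_vec k i - unit_vec k j) x $ l = x $ Transposition.transpose i j l"
proof -
  let ?\<alpha> = "unit_vec k i - unit_vec k j :: real vec"
  have s: "scalar_prod y ?\<alpha> = y $ i - y $ j" if "y \<in> carrier_vec k" for y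
    using that assms by (simp add: scalar_prod_minus_distrib[of _ k])
  have "scalar_prod ?\<alpha> ?\<alpha> = 2"
    using assms by (subst s) auto
  then show ?thesis
    using assms s[of x] by (auto simp: reflection_def Transposition.transpose_def field_simps)
qed

lemma reflection_flip:
  assumes "0 < k" "x \<in> carrier_vec k" "l < k"
  shows "reflection (unit_vec k 0) x $ l = (if l = 0 then - (x $ l) else x $ l)"
  using assms by (auto simp: reflection_def)

lemma wall_normals_carrier: "0 < k \<Longrightarrow> \<alpha> \<in> wall_normals k \<Longrightarrow> \<alpha> \<in> carrier_vec k"
  by (auto simp: wall_normals_def)

lemma reflection_carrier:
  "x \<in> carrier_vec k \<Longrightarrow> \<alpha> \<in> carrier_vec k \<Longrightarrow> reflection \<alpha> x \<in> carrier_vec k"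
  by (auto simp: reflection_def)

lemma reflection_add:
  assumes "x \<in> carrier_vec k" "y \<in> carrier_vec k" "\<alpha> \<in> carrier_vec k"
  shows "reflection \<alpha> (x + y) = reflection \<alpha> x + reflection \<alpha> y"
  using assms
  by (intro eq_vecI) (auto simp: reflection_def add_scalar_prod_distrib[of _ k] add_divide_distrib distrib_left distrib_right)

lemma reflection_reflection:
  assumes "x \<in> carrier_vec k" "\<alpha> \<in> wall_normals k" "0 < k"
  shows "reflection \<alpha> (reflection \<alpha> x) = x"
proof -
  have c: "\<alpha> \<in> carrier_vec k" using assms by (simp add: wall_normals_carrier)
  note cc = reflection_carrier[OF reflection_carrier[OF assms(1) c] c] reflection_carrier[OF assms(1) c]
  consider i j where "i < j" "j < k" "\<alpha> = unit_vec k i - unit_vec k j" | "\<alpha> = unit_vec k 0"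
    using assms by (auto simp: wall_normals_def)
  then show ?thesis
  proof cases
    case 1
    show ?thesis
    proof (rule eq_vecI)
      fix l assume "l < dim_vec x"
      then have l: "l < k" using assms by auto
      have "Transposition.transpose i j l < k" using l 1 by (auto simp: Transposition.transpose_def)
      then show "reflection \<alpha> (reflection \<alpha> x) $ l = x $ l"
        using 1 l assms cc by (simp add: reflection_swap)
    qed (use assms cc in auto)
  next
    case 2
    show ?thesis
      by (rule eq_vecI) (use assms 2 cc in \<open>auto simp: reflection_flip\<close>)
  qed
qed

lemma sum_steps_carrier:
  "u \<in> carrier_vec k \<Longrightarrow> set as \<subseteq> carrier_vec k \<Longrightarrow> foldl (+) u as \<in> carrier_vec k"
  by (induction as arbitrary: u) auto

lemma foldl_add_vec:
  assumes "u \<in> carrier_vec k" "set as \<subseteq> carrier_vec k"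
  shows "foldl (+) u as = (u :: real vec) + foldl (+) (0\<^sub>v k) as"
  using assms
proof (induction as arbitrary: u)
  case (Cons a as)
  have "foldl (+) u (a # as) = (u + a) + foldl (+) (0\<^sub>v k) as"
    using Cons.IH[of "u + a"] Cons.prems by simp
  moreover have "foldl (+) (0\<^sub>v k) (a # as) = a + foldl (+) (0\<^sub>v k) as"
    using Cons.IH[of a] Cons.prems by simp
  moreover have "foldl (+) (0\<^sub>v k) as \<in> carrier_vec k"
    using Cons.prems by (intro sum_steps_carrier) auto
  ultimately show ?case using Cons.prems by (simp add: assoc_add_vec[of _ k])
qed simp

lemma foldl_map_reflection:
  assumes "u \<in> carrier_vec k" "set as \<subseteq> carrier_vec k" "\<alpha> \<in> carrier_vec k"
  shows "foldl (+) (reflection \<alpha> u) (map (reflection \<alpha>) as) = reflection \<alpha> (foldl (+) u as)"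
  using assms by (induction as arbitrary: u) (auto simp flip: reflection_add)

text \<open>The Leibniz formula with the permutation acting on the variables: each
  \<open>u j\<close> then occurs in one factor only, so changes of \<open>u\<close> can be followed
  factor by factor.\<close>

lemma alternant_det_col:
  "alternant k u x = (\<Sum>p | p permutes {0..<k}. signof p * (\<Prod>j<k. x (p j) powi u j - x (p j) powi (- u j)))"
  unfolding alternant_def
  by (subst det_col[of _ k]) (auto intro!: sum.cong prod.cong simp: permutes_in_image)

lemma alternant_negate:
  assumes "c < k"
  shows "alternant k (u(c := - u c)) x = - alternant k u x"
proof -
  have "(\<Prod>j<k. x (p j) powi (u(c := - u c)) j - x (p j) powi (- (u(c := - u c)) j)) =
    - (\<Prod>j<k. x (p j) powi u j - x (p j) powi (- u j))" for p
  proof -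
    have "(\<Prod>j\<in>{..<k} - {c}. x (p j) powi (u(c := - u c)) j - x (p j) powi (- (u(c := - u c)) j)) =
       (\<Prod>j\<in>{..<k} - {c}. x (p j) powi u j - x (p j) powi (- u j))"
      by (rule prod.cong) auto
    then show ?thesis
      using assms by (subst (1 2) prod.remove[of _ c]) (auto simp: algebra_simps)
  qed
  then show ?thesis by (simp add: alternant_det_col sum_negf)
qed

lemma alternant_swap:
  assumes "a < k" "b < k" "a \<noteq> b"
  shows "alternant k (u \<circ> Transposition.transpose a b) x = - alternant k u x"
proof -
  let ?M = "Matrix.mat k k (\<lambda>(j, m). x j powi u m - x j powi (- u m))"
  have "Matrix.mat k k (\<lambda>(j, m). x j powi (u \<circ> Transposition.transpose a b) m - x j powi (- (u \<circ> Transposition.transpose a b) m)) = swapcols a b ?M"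
    by (rule eq_matI) (use assms in \<open>auto simp: Transposition.transpose_def\<close>)
  then show ?thesis
    unfolding alternant_def using det_swapcols[OF assms, of ?M] by simp
qed

section \<open>Lattice steps and the walls of the chamber\<close>

locale step_model =
  fixes k :: nat and A :: "real vec set" and S :: "real vec list set" and w :: "real vec list \<Rightarrow> real"
  assumes k_pos: "0 < k"
    and atomic: "A = axis_steps k \<or> A = diagonal_steps k"
    and steps: "composite_step_set k A S"
    and weight: "step_weight k S w"
begin

lemma finite_S: "finite S"
  using steps by (simp add: composite_step_set_def)

lemma atomic_carrier: "A \<subseteq> carrier_vec k"
  using atomic by (auto simp: axis_steps_def diagonal_steps_def)

lemma set_step: "as \<in> S \<Longrightarrow> set as \<subseteq> A"
  using steps by (auto simp: composite_step_set_def)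

lemma set_step_carrier: "as \<in> S \<Longrightarrow> set as \<subseteq> carrier_vec k"
  using set_step atomic_carrier by blast

lemma atomic_Ints: "a \<in> A \<Longrightarrow> i < k \<Longrightarrow> a $ i \<in> \<int>"
  using atomic by (auto simp: axis_steps_def diagonal_steps_def)

lemma sum_Ints:
  assumes "u \<in> carrier_vec k" "\<And>i. i < k \<Longrightarrow> u $ i \<in> \<int>" "set as \<subseteq> A" "i < k"
  shows "foldl (+) u as $ i \<in> \<int>"
  using assms
proof (induction as arbitrary: u)
  case (Cons a as)
  have a: "a \<in> carrier_vec k" "a \<in> A" using Cons.prems atomic_carrier by auto
  have "foldl (+) (u + a) as $ i \<in> \<int>"
  proof (rule Cons.IH)
    show "(u + a) $ j \<in> \<int>" if "j < k" for j
      using Cons.prems(2)[OF that] atomic_Ints[OF a(2) that] a(1) that by simp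
  qed (use Cons.prems a in auto)
  then show ?case by simp
qed auto

lemma lattice_carrier: "u \<in> lattice_span k A \<Longrightarrow> u \<in> carrier_vec k"
  by (induction rule: lattice_span.induct) (use atomic_carrier in auto)

lemma lattice_Ints: "u \<in> lattice_span k A \<Longrightarrow> i < k \<Longrightarrow> u $ i \<in> \<int>"
proof (induction rule: lattice_span.induct)
  case (add x a)
  then show ?case using atomic_Ints[of a i] atomic_carrier by auto
next
  case (diff x a)
  then show ?case using atomic_Ints[of a i] atomic_carrier by auto
qed auto

lemma sum_lattice: "u \<in> lattice_span k A \<Longrightarrow> set as \<subseteq> A \<Longrightarrow> foldl (+) u as \<in> lattice_span k A"
  by (induction as arbitrary: u) (auto intro: lattice_span.add)

text \<open>A diagonal step changes every coordinate by 1 or -1, so all coordinates of a lattice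
  point have the same parity.\<close>

lemma lattice_even_gap:
  assumes "A = diagonal_steps k" "p \<in> lattice_span k A" "i < k" "j < k"
  shows "(p $ j - p $ i) / 2 \<in> \<int>"
proof -
  have diag: "(a $ j - a $ i) / 2 \<in> \<int>" if a: "a \<in> A" for a
  proof -
    obtain e where e: "a = vec k e" "\<forall>j<k. e j \<in> {-1, 1}"
      using a unfolding assms(1) diagonal_steps_def by blast
    then have "e i \<in> {-1, 1}" "e j \<in> {-1, 1}" using assms(3,4) by auto
    then show ?thesis using e(1) assms(3,4) by auto
  qed
  show ?thesis
    using assms(2)
  proof (induction rule: lattice_span.induct)
    case (add x a)
    have "((x + a) $ j - (x + a) $ i) / 2 = (x $ j - x $ i) / 2 + (a $ j - a $ i) / 2"
      using add.hyps(2) atomic_carrier assms(3,4) by (auto simp: field_simps)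
    then show ?case using add diag[of a] by (metis Ints_add)
  next
    case (diff x a)
    have "((x - a) $ j - (x - a) $ i) / 2 = (x $ j - x $ i) / 2 - (a $ j - a $ i) / 2"
      using diff.hyps(2) atomic_carrier assms(3,4) by (auto simp: field_simps)
    then show ?case using diff diag[of a] by (metis Ints_diff)
  qed (use assms in auto)
qed

text \<open>No atomic step jumps over a wall between two coordinates: for axis steps the gap is at
  least 1 and shrinks by at most 1; for diagonal steps parity makes it at least 2, and it shrinks by
  at most 2.\<close>

lemma gap_ge_step:
  assumes p: "p \<in> weyl_chamber k" "p \<in> lattice_span k A" and a: "a \<in> A" and ij: "i < j" "j < k"
  shows "a $ i - a $ j \<le> p $ j - p $ i"
proof -
  have pos: "0 < p $ j - p $ i" using p(1) ij by (auto simp: weyl_chamber_def)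
  have int_pos: "1 \<le> y" if "y \<in> \<int>" "0 < y" for y :: real
    using that by (auto elim!: Ints_cases)
  from atomic show ?thesis
  proof
    assume A: "A = axis_steps k"
    have "1 \<le> p $ j - p $ i"
      by (rule int_pos) (use pos p(2) ij lattice_Ints[OF p(2)] in auto)
    moreover have "a $ i - a $ j \<le> 1"
      using a ij by (auto simp: A axis_steps_def)
    ultimately show ?thesis by linarith
  next
    assume A: "A = diagonal_steps k"
    have "1 \<le> (p $ j - p $ i) / 2"
      by (rule int_pos) (use pos p(2) ij in \<open>auto intro: lattice_even_gap[OF A]\<close>)
    then have "2 \<le> p $ j - p $ i" by simp
    moreover have "a $ i - a $ j \<le> 2"
    proof -
      obtain e where e: "a = vec k e" "\<forall>j<k. e j \<in> {-1, 1}"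
        using a unfolding A diagonal_steps_def by blast
      then have "e i \<in> {-1, 1}" "e j \<in> {-1, 1}" using ij by auto
      then show ?thesis using e(1) ij by auto
    qed
    ultimately show ?thesis by linarith
  qed
qed

text \<open>The basis of the reflection principle. Coordinates are integers moving by at most 1, and
  gaps cannot become negative in one step, so a point just outside the open chamber lies on one of
  its walls.\<close>

lemma wall_hit:
  assumes p: "p \<in> weyl_chamber k" "p \<in> lattice_span k A" and a: "a \<in> A" and out: "p + a \<notin> weyl_chamber k"
  shows "\<exists>\<alpha>\<in>wall_normals k. reflection \<alpha> (p + a) = p + a"
proof -
  have c: "p \<in> carrier_vec k" "a \<in> carrier_vec k"
    using p a atomic_carrier by (auto simp: weyl_chamber_def)
  have pos: "1 \<le> p $ i" if "i < k" for i
    using lattice_Ints[OF p(2) that] p(1) that by (auto simp: weyl_chamber_def elim!: Ints_cases)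
  have step: "- 1 \<le> a $ i" if "i < k" for i
    using atomic a that by (fastforce simp: axis_steps_def diagonal_steps_def)
  consider i where "i < k" "(p + a) $ i \<le> 0" | i j where "i < j" "j < k" "(p + a) $ j \<le> (p + a) $ i"
    using out c unfolding weyl_chamber_def by (force simp: not_less)
  then show ?thesis
  proof cases
    case 1
    then have "p $ i + a $ i \<le> 0" using c by simp
    then have eq: "p $ i = 1" "a $ i = - 1" using pos[of i] step[of i] 1 by linarith+
    \<comment> \<open>In the chamber the coordinates are strictly increasing integers from 1 on, so
      only the first can equal 1.\<close>
    have "i = 0"
    proof (rule ccontr)
      assume "i \<noteq> 0"
      then have "p $ 0 < p $ i" using p(1) 1 by (auto simp: weyl_chamber_def)
      then show False using pos[OF k_pos] eq by linarith
    qed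
    then have "reflection (unit_vec k 0) (p + a) = p + a"
      using eq c k_pos by (intro eq_vecI) (auto simp: reflection_flip reflection_def)
    then show ?thesis by (auto simp: wall_normals_def)
  next
    case 2
    have "p $ j + a $ j = p $ i + a $ i"
      using gap_ge_step[OF p a 2(1,2)] 2 c by simp
    then have "reflection (unit_vec k i - unit_vec k j) (p + a) = p + a"
    proof (intro eq_vecI)
      fix l assume "l < dim_vec (p + a)"
      then have "l < k" using c by simp
      then have "reflection (unit_vec k i - unit_vec k j) (p + a) $ l = (p + a) $ Transposition.transpose i j l"
        using 2 c by (intro reflection_swap) auto
      then show "reflection (unit_vec k i - unit_vec k j) (p + a) $ l = (p + a) $ l"
        using \<open>p $ j + a $ j = p $ i + a $ i\<close> 2 c by (auto simp: Transposition.transpose_def)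
    qed (use c in \<open>auto simp: reflection_def\<close>)
    then show ?thesis using 2 by (auto simp: wall_normals_def)
  qed
qed

section \<open>Invariance of the step set under the reflection group\<close>

lemma reflect_in_group: "\<alpha> \<in> wall_normals k \<Longrightarrow> reflection \<alpha> \<in> reflection_group k"
  using reflection_group.comp[OF _ reflection_group.id, of \<alpha> k] by simp

lemma map_group:
  assumes "as \<in> S" "g \<in> reflection_group k"
  shows "map g as \<in> S" "w (map g as) = w as"
proof -
  have "reflect_prefix g (length as) as = map g as" by (simp add: reflect_prefix_def)
  then show "map g as \<in> S" "w (map g as) = w as"
    using assms steps weight order_refl[of "length as"]
    unfolding composite_step_set_def step_weight_def by metis+
qed

text \<open>Closure is given for prefixes. Reflecting the whole step and then its prefix once more
  restores the prefix and leaves the suffix reflected.\<close>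

lemma reflect_suffix:
  assumes "as \<in> S" "\<alpha> \<in> wall_normals k" "j \<le> length as"
  shows "take j as @ map (reflection \<alpha>) (drop j as) \<in> S"
    "w (take j as @ map (reflection \<alpha>) (drop j as)) = w as"
proof -
  let ?r = "reflection \<alpha>"
  have r: "?r \<in> reflection_group k" using assms(2) by (rule reflect_in_group)
  have "map ?r (map ?r (take j as)) = take j as"
    unfolding map_map
    by (rule map_idI) (use set_step_carrier[OF assms(1)] assms(2) k_pos in
        \<open>auto intro!: reflection_reflection dest: in_set_takeD\<close>)
  then have "reflect_prefix ?r j (map ?r as) = take j as @ map ?r (drop j as)"
    by (simp add: reflect_prefix_def take_map drop_map)
  moreover have "reflect_prefix ?r j (map ?r as) \<in> S" "w (reflect_prefix ?r j (map ?r as)) = w (map ?r as)"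
    using map_group(1)[OF assms(1) r] r assms(3) steps weight
    by (auto simp: composite_step_set_def step_weight_def)
  ultimately show "take j as @ map ?r (drop j as) \<in> S" "w (take j as @ map ?r (drop j as)) = w as"
    using map_group(2)[OF assms(1) r] by simp_all
qed

text \<open>The total displacement in integer coordinates. The value 0 from \<open>k\<close> on lets
  reflections act by equations between functions on all of \<open>nat\<close>.\<close>

definition disp :: "real vec list \<Rightarrow> nat \<Rightarrow> int" where
  "disp as i = (if i < k then \<lfloor>foldl (+) (0\<^sub>v k) as $ i\<rfloor> else 0)"

lemma disp_reflection_swap:
  assumes "as \<in> S" "i < j" "j < k"
  shows "disp (map (reflection (unit_vec k i - unit_vec k j)) as) = disp as \<circ> Transposition.transpose i j"
proof -
  let ?\<alpha> = "unit_vec k i - unit_vec k j :: real vec"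
  have "reflection ?\<alpha> (0\<^sub>v k) = 0\<^sub>v k"
    using assms by (intro eq_vecI) (auto simp: reflection_def)
  then have "foldl (+) (0\<^sub>v k) (map (reflection ?\<alpha>) as) = reflection ?\<alpha> (foldl (+) (0\<^sub>v k) as)"
    using foldl_map_reflection[of "0\<^sub>v k" k as ?\<alpha>] set_step_carrier[OF assms(1)] by simp
  moreover have "foldl (+) (0\<^sub>v k) as \<in> carrier_vec k"
    using set_step_carrier[OF assms(1)] by (intro sum_steps_carrier) auto
  ultimately show ?thesis
    using assms by (auto simp: disp_def fun_eq_iff reflection_swap Transposition.transpose_def)
qed

lemma disp_reflection_flip:
  assumes "as \<in> S"
  shows "disp (map (reflection (unit_vec k 0)) as) = (disp as)(0 := - disp as 0)"
proof -
  let ?\<alpha> = "unit_vec k 0 :: real vec"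
  have "reflection ?\<alpha> (0\<^sub>v k) = 0\<^sub>v k"
    using assms by (intro eq_vecI) (auto simp: reflection_def)
  then have "foldl (+) (0\<^sub>v k) (map (reflection ?\<alpha>) as) = reflection ?\<alpha> (foldl (+) (0\<^sub>v k) as)"
    using foldl_map_reflection[of "0\<^sub>v k" k as ?\<alpha>] set_step_carrier[OF assms(1)] by simp
  moreover have "foldl (+) (0\<^sub>v k) as \<in> carrier_vec k"
    using set_step_carrier[OF assms(1)] by (intro sum_steps_carrier) auto
  moreover have "foldl (+) (0\<^sub>v k) as $ 0 \<in> \<int>"
    using set_step[OF assms(1)] k_pos by (intro sum_Ints) auto
  ultimately show ?thesis
    using k_pos by (auto simp: disp_def fun_eq_iff reflection_flip elim!: Ints_cases)
qed

lemma sum_reflect: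
  fixes \<Phi> :: "(nat \<Rightarrow> int) \<Rightarrow> complex"
  assumes "\<alpha> \<in> wall_normals k"
  shows "(\<Sum>as\<in>S. of_real (w as) * \<Phi> (disp (map (reflection \<alpha>) as))) = (\<Sum>as\<in>S. of_real (w as) * \<Phi> (disp as))"
proof (rule sum.reindex_bij_witness[of S "map (reflection \<alpha>)" "map (reflection \<alpha>)"])
  fix as assume as: "as \<in> S"
  note r = reflect_in_group[OF assms]
  show "map (reflection \<alpha>) (map (reflection \<alpha>) as) = as"
    unfolding map_map
    by (rule map_idI) (use set_step_carrier[OF as] assms k_pos in \<open>auto intro!: reflection_reflection\<close>)
  then show "map (reflection \<alpha>) (map (reflection \<alpha>) as) = as" .
  show "map (reflection \<alpha>) as \<in> S" by (rule map_group[OF as r])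
  then show "map (reflection \<alpha>) as \<in> S" .
  show "of_real (w (map (reflection \<alpha>) as)) * \<Phi> (disp (map (reflection \<alpha>) as)) =
     of_real (w as) * \<Phi> (disp (map (reflection \<alpha>) as))"
    using map_group(2)[OF as r] by simp
qed

lemma sum_transpose:
  fixes \<Phi> :: "(nat \<Rightarrow> int) \<Rightarrow> complex"
  assumes "i < k" "j < k"
  shows "(\<Sum>as\<in>S. of_real (w as) * \<Phi> (disp as \<circ> Transposition.transpose i j)) = (\<Sum>as\<in>S. of_real (w as) * \<Phi> (disp as))"
proof -
  have *: "(\<Sum>as\<in>S. of_real (w as) * \<Phi> (disp as \<circ> Transposition.transpose i j)) = (\<Sum>as\<in>S. of_real (w as) * \<Phi> (disp as))"
    if "i < j" "j < k" for i j
    using sum_reflect[of "unit_vec k i - unit_vec k j" \<Phi>] that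
    by (auto simp: wall_normals_def disp_reflection_swap cong: sum.cong)
  consider "i < j" | "i = j" | "j < i" by linarith
  then show ?thesis
    by cases (use assms *[of i j] *[of j i] in \<open>auto simp: Transposition.transpose_commute\<close>)
qed

lemma sum_negate:
  fixes \<Phi> :: "(nat \<Rightarrow> int) \<Rightarrow> complex"
  assumes "c < k"
  shows "(\<Sum>as\<in>S. of_real (w as) * \<Phi> ((disp as)(c := - disp as c))) = (\<Sum>as\<in>S. of_real (w as) * \<Phi> (disp as))"
proof -
  let ?t = "Transposition.transpose 0 c"
  \<comment> \<open>The sign change at \<open>c\<close> is the one at 0 conjugated by the
    transposition of 0 and \<open>c\<close>.\<close>
  have eq: "((s \<circ> ?t)(0 := - (s \<circ> ?t) 0)) \<circ> ?t = s(c := - s c)" for s :: "nat \<Rightarrow> int"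
    by (auto simp: fun_eq_iff Transposition.transpose_def)
  have "(\<Sum>as\<in>S. of_real (w as) * \<Phi> ((disp as)(c := - disp as c))) =
     (\<Sum>as\<in>S. of_real (w as) * \<Phi> (((disp as)(0 := - disp as 0)) \<circ> ?t))"
    using sum_transpose[OF k_pos assms, of "\<lambda>s. \<Phi> ((s(0 := - s 0)) \<circ> ?t)"] unfolding eq .
  also have "\<dots> = (\<Sum>as\<in>S. of_real (w as) * \<Phi> (disp as \<circ> ?t))"
    using sum_reflect[of "unit_vec k 0" "\<lambda>s. \<Phi> (s \<circ> ?t)"] k_pos
    by (auto simp: wall_normals_def disp_reflection_flip cong: sum.cong)
  also have "\<dots> = (\<Sum>as\<in>S. of_real (w as) * \<Phi> (disp as))"
    by (rule sum_transpose[OF k_pos assms])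
  finally show ?thesis .
qed

lemma sum_permute:
  fixes \<Phi> :: "(nat \<Rightarrow> int) \<Rightarrow> complex"
  assumes "p permutes {0..<k}"
  shows "(\<Sum>as\<in>S. of_real (w as) * \<Phi> (disp as \<circ> p)) = (\<Sum>as\<in>S. of_real (w as) * \<Phi> (disp as))"
proof (rule permutes_induct[OF assms])
  fix a b p
  assume "a \<in> {0..<k}" "b \<in> {0..<k}"
    and "(\<Sum>as\<in>S. of_real (w as) * \<Phi> (disp as \<circ> p)) = (\<Sum>as\<in>S. of_real (w as) * \<Phi> (disp as))"
  then show "(\<Sum>as\<in>S. of_real (w as) * \<Phi> (disp as \<circ> (Transposition.transpose a b \<circ> p))) = (\<Sum>as\<in>S. of_real (w as) * \<Phi> (disp as))"
    using sum_transpose[of a b "\<lambda>s. \<Phi> (s \<circ> p)"] by (simp add: comp_assoc)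
qed auto

text \<open>\<open>S\<close> is invariant under the sign change of each single coordinate, so only
  the even part of each factor matters. Factors are exchanged one coordinate at a time.\<close>

lemma sum_prod_symmetrize:
  fixes G H :: "nat \<Rightarrow> int \<Rightarrow> complex"
  assumes "\<And>i s. i < k \<Longrightarrow> G i s + G i (- s) = H i s + H i (- s)"
  shows "(\<Sum>as\<in>S. of_real (w as) * (\<Prod>i<k. G i (disp as i))) = (\<Sum>as\<in>S. of_real (w as) * (\<Prod>i<k. H i (disp as i)))"
proof -
  have one: "(\<Sum>as\<in>S. of_real (w as) * (\<Prod>i<k. K i (disp as i))) = (\<Sum>as\<in>S. of_real (w as) * (\<Prod>i<k. L i (disp as i)))"
    if c: "c < k" and other: "\<And>i. i < k \<Longrightarrow> i \<noteq> c \<Longrightarrow> K i = L i"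
      and sym: "\<And>s. K c s + K c (- s) = L c s + L c (- s)" for c and K L :: "nat \<Rightarrow> int \<Rightarrow> complex"
  proof -
    \<comment> \<open>Adding the sum to its image under the sign change at \<open>c\<close> exhibits
      the even part of the factor at \<open>c\<close>.\<close>
    have dbl: "2 * (\<Sum>as\<in>S. of_real (w as) * (\<Prod>i<k. M i (disp as i))) =
      (\<Sum>as\<in>S. of_real (w as) * ((M c (disp as c) + M c (- disp as c)) * (\<Prod>i\<in>{..<k} - {c}. M i (disp as i))))"
      for M :: "nat \<Rightarrow> int \<Rightarrow> complex"
    proof -
      have rem: "(\<Prod>i<k. M i (s i)) = M c (s c) * (\<Prod>i\<in>{..<k} - {c}. M i (s i))" for s
        by (rule prod.remove) (use c in auto)
      have upd: "(\<Prod>i\<in>{..<k} - {c}. M i ((s(c := y)) i)) = (\<Prod>i\<in>{..<k} - {c}. M i (s i))" for s y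
        by (rule prod.cong) auto
      have "(\<Sum>as\<in>S. of_real (w as) * (\<Prod>i<k. M i (disp as i))) =
         (\<Sum>as\<in>S. of_real (w as) * (M c (- disp as c) * (\<Prod>i\<in>{..<k} - {c}. M i (disp as i))))"
        using sum_negate[OF c, of "\<lambda>s. \<Prod>i<k. M i (s i)"] unfolding rem upd by simp
      then have "2 * (\<Sum>as\<in>S. of_real (w as) * (\<Prod>i<k. M i (disp as i))) =
         (\<Sum>as\<in>S. of_real (w as) * (M c (disp as c) * (\<Prod>i\<in>{..<k} - {c}. M i (disp as i)))) +
         (\<Sum>as\<in>S. of_real (w as) * (M c (- disp as c) * (\<Prod>i\<in>{..<k} - {c}. M i (disp as i))))"
        unfolding rem by simp
      then show ?thesis by (simp add: sum.distrib[symmetric] distrib_left distrib_right)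
    qed
    have "(\<Prod>i\<in>{..<k} - {c}. K i (s i)) = (\<Prod>i\<in>{..<k} - {c}. L i (s i))" for s
      by (rule prod.cong) (use other in auto)
    then have "2 * (\<Sum>as\<in>S. of_real (w as) * (\<Prod>i<k. K i (disp as i))) =
        2 * (\<Sum>as\<in>S. of_real (w as) * (\<Prod>i<k. L i (disp as i)))"
      unfolding dbl sym by simp
    then show ?thesis by simp
  qed
  have all: "m \<le> k \<Longrightarrow> (\<Sum>as\<in>S. of_real (w as) * (\<Prod>i<k. (if i < m then H i else G i) (disp as i))) =
     (\<Sum>as\<in>S. of_real (w as) * (\<Prod>i<k. G i (disp as i)))" for m
  proof (induction m)
    case (Suc m)
    have "(\<Sum>as\<in>S. of_real (w as) * (\<Prod>i<k. (if i < Suc m then H i else G i) (disp as i))) =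
       (\<Sum>as\<in>S. of_real (w as) * (\<Prod>i<k. (if i < m then H i else G i) (disp as i)))"
      by (rule one[of m]) (use Suc.prems assms[of m] in auto)
    with Suc show ?case by simp
  qed auto
  have "(\<Prod>i<k. (if i < k then H i else G i) (disp as i)) = (\<Prod>i<k. H i (disp as i))" for as
    by (rule prod.cong) auto
  with all[of k] show ?thesis by simp
qed

lemma step_gf_disp:
  "step_gf k S w (vec k x) = (\<Sum>as\<in>S. of_real (w as) * (\<Prod>i<k. x i powi disp as i))"
  unfolding step_gf_def by (auto intro!: sum.cong prod.cong simp: disp_def)

text \<open>For each Leibniz term, permutation invariance aligns the exponents of the generating
  function with \<open>u\<close>. Symmetrization then applies, because with
  \<open>R b = y powi b - y powi (- b)\<close> one has
  \<open>R b * (y powi s + y powi (- s)) = R (b + s) + R (b - s)\<close>.\<close>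

lemma alternant_mult_step_gf:
  assumes "\<And>j. j < k \<Longrightarrow> x j \<noteq> 0"
  shows "alternant k u x * step_gf k S w (vec k x) =
    (\<Sum>as\<in>S. of_real (w as) * alternant k (\<lambda>i. u i + disp as i) x)"
proof -
  define R where "R = (\<lambda>y b. y powi b - y powi (- b) :: complex)"
  have "(\<Prod>j<k. R (x (p j)) (u j)) * step_gf k S w (vec k x) =
     (\<Sum>as\<in>S. of_real (w as) * (\<Prod>j<k. R (x (p j)) (u j + disp as j)))" if p: "p permutes {0..<k}" for p
  proof -
    have pk: "p permutes {..<k}" using p by (simp add: atLeast0LessThan)
    have "step_gf k S w (vec k x) = (\<Sum>as\<in>S. of_real (w as) * (\<Prod>j<k. x (p j) powi disp as (p j)))"
      unfolding step_gf_disp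
      by (intro sum.cong arg_cong2[where f = "(*)"] refl prod.permute[OF pk, unfolded comp_def])
    also have "\<dots> = (\<Sum>as\<in>S. of_real (w as) * (\<Prod>j<k. x (p j) powi disp as j))"
      using sum_permute[OF p, of "\<lambda>s. \<Prod>j<k. x (p j) powi s j"] by simp
    finally have "(\<Prod>j<k. R (x (p j)) (u j)) * step_gf k S w (vec k x) =
       (\<Sum>as\<in>S. of_real (w as) * (\<Prod>j<k. R (x (p j)) (u j) * x (p j) powi disp as j))"
      by (simp add: sum_distrib_left prod.distrib mult_ac)
    also have "\<dots> = (\<Sum>as\<in>S. of_real (w as) * (\<Prod>j<k. R (x (p j)) (u j + disp as j)))"
    proof (rule sum_prod_symmetrize)
      fix i s assume "i < k"
      then have "p i < k" using permutes_in_image[OF pk, of i] by simp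
      then have nz: "x (p i) \<noteq> 0" using assms by simp
      show "R (x (p i)) (u i) * x (p i) powi s + R (x (p i)) (u i) * x (p i) powi (- s) =
         R (x (p i)) (u i + s) + R (x (p i)) (u i + - s)"
        using nz by (simp add: R_def power_int_add power_int_diff power_int_minus field_simps)
    qed
    finally show ?thesis .
  qed
  then have "alternant k u x * step_gf k S w (vec k x) =
     (\<Sum>p | p permutes {0..<k}. signof p * (\<Sum>as\<in>S. of_real (w as) * (\<Prod>j<k. R (x (p j)) (u j + disp as j))))"
    unfolding alternant_det_col R_def sum_distrib_right mult.assoc by (intro sum.cong) auto
  also have "\<dots> = (\<Sum>as\<in>S. of_real (w as) * alternant k (\<lambda>i. u i + disp as i) x)"
    unfolding alternant_det_col R_def sum_distrib_left
    by (subst sum.swap) (simp add: mult_ac)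
  finally show ?thesis .
qed

section \<open>Decomposition of walks into steps\<close>

definition stays :: "real vec \<Rightarrow> real vec list \<Rightarrow> bool" where
  "stays u as \<longleftrightarrow> (\<forall>i\<le>length as. foldl (+) u (take i as) \<in> weyl_chamber k)"

definition walks :: "nat \<Rightarrow> real vec \<Rightarrow> real vec list list set" where
  "walks n u = {ss. length ss = n \<and> set ss \<subseteq> S \<and> stays u (concat ss)}"

lemma stays_append: "stays u (as @ bs) \<longleftrightarrow> stays u as \<and> stays (foldl (+) u as) bs"
proof
  assume l: "stays u (as @ bs)"
  show "stays u as \<and> stays (foldl (+) u as) bs"
    unfolding stays_def
  proof (intro conjI allI impI)
    fix i assume "i \<le> length as"
    then show "foldl (+) u (take i as) \<in> weyl_chamber k"
      using l[unfolded stays_def, rule_format, of i] by simp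
  next
    fix i assume "i \<le> length bs"
    then show "foldl (+) (foldl (+) u as) (take i bs) \<in> weyl_chamber k"
      using l[unfolded stays_def, rule_format, of "length as + i"] by simp
  qed
next
  assume r: "stays u as \<and> stays (foldl (+) u as) bs"
  show "stays u (as @ bs)"
    unfolding stays_def
  proof (intro allI impI)
    fix i assume i: "i \<le> length (as @ bs)"
    show "foldl (+) u (take i (as @ bs)) \<in> weyl_chamber k"
    proof (cases "i \<le> length as")
      case True
      then show ?thesis using r by (simp add: stays_def)
    next
      case False
      then show ?thesis
        using i conjunct2[OF r, unfolded stays_def, rule_format, of "i - length as"] by simp
    qed
  qed
qed

lemma finite_walks: "finite (walks n u)"
  by (rule finite_subset[OF _ finite_lists_length_eq[OF finite_S, of n]]) (auto simp: walks_def)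

text \<open>Only end points of walks contribute, so the infinite sum reduces to a finite one that
  groups the walks by end point.\<close>

lemma free_walk_count_eq: "free_walk_count k S w n u = (\<Sum>ss\<in>walks n u. prod_list (map w ss))"
proof -
  define e where "e = (\<lambda>ss. foldl (+) u (concat ss))"
  have in_chamber: "walks_in_chamber k S n u v = {ss \<in> walks n u. e ss = v}" for v
    by (auto simp: walks_in_chamber_def walks_def stays_def e_def)
  have e: "e ss \<in> weyl_chamber k" if "ss \<in> walks n u" for ss
    using that unfolding walks_def stays_def e_def by (metis (mono_tags, lifting) mem_Collect_eq order_refl take_all)
  have "free_walk_count k S w n u = (\<Sum>\<^sub>\<infinity>v\<in>e ` walks n u. walk_count k S w n u v)"
    unfolding free_walk_count_def
  proof (rule infsum_cong_neutral)
    fix v assume "v \<in> weyl_chamber k - e ` walks n u"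
    then have "walks_in_chamber k S n u v = {}" by (auto simp: in_chamber)
    then show "walk_count k S w n u v = 0" by (simp add: walk_count_def)
  qed (use e in auto)
  also have "\<dots> = (\<Sum>v\<in>e ` walks n u. \<Sum>ss | ss \<in> walks n u \<and> e ss = v. prod_list (map w ss))"
    by (simp add: finite_walks walk_count_def in_chamber)
  also have "\<dots> = (\<Sum>ss\<in>walks n u. prod_list (map w ss))"
    by (rule sum.group) (auto simp: finite_walks)
  finally show ?thesis .
qed

lemma free_walk_count_0: "u \<in> weyl_chamber k \<Longrightarrow> free_walk_count k S w 0 u = 1"
proof -
  assume "u \<in> weyl_chamber k"
  then have "walks 0 u = {[]}" by (auto simp: walks_def stays_def)
  then show ?thesis by (simp add: free_walk_count_eq)
qed

lemma free_walk_count_Suc: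
  "free_walk_count k S w (Suc n) u =
     (\<Sum>as | as \<in> S \<and> stays u as. w as * free_walk_count k S w n (foldl (+) u as))"
proof -
  have "walks (Suc n) u = (\<lambda>(as, ss). as # ss) ` (SIGMA as:{as. as \<in> S \<and> stays u as}. walks n (foldl (+) u as))"
    by (auto simp: walks_def stays_append length_Suc_conv image_iff)
  moreover have "inj_on (\<lambda>(as, ss). as # ss) X" for X :: "(real vec list \<times> real vec list list) set"
    by (auto simp: inj_on_def)
  ultimately have "free_walk_count k S w (Suc n) u =
      (\<Sum>(as, ss)\<in>(SIGMA as:{as. as \<in> S \<and> stays u as}. walks n (foldl (+) u as)). w as * prod_list (map w ss))"
    by (simp add: free_walk_count_eq sum.reindex case_prod_unfold)
  then show ?thesis
    using finite_S by (simp add: free_walk_count_eq sum.Sigma finite_walks sum_distrib_left)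
qed

section \<open>Cancellation of the steps that leave the chamber\<close>

lemma alternant_endpoint:
  assumes "u \<in> lattice_span k A" "as \<in> S"
  shows "alternant k (\<lambda>i. \<lfloor>u $ i\<rfloor> + disp as i) x = alternant k (\<lambda>i. \<lfloor>foldl (+) u as $ i\<rfloor>) x"
proof (rule alternant_cong)
  fix i assume i: "i < k"
  have c: "u \<in> carrier_vec k" "set as \<subseteq> carrier_vec k" "foldl (+) (0\<^sub>v k) as \<in> carrier_vec k"
    using assms lattice_carrier set_step_carrier sum_steps_carrier[of "0\<^sub>v k" k as] by auto
  then have "foldl (+) u as $ i = u $ i + foldl (+) (0\<^sub>v k) as $ i"
    using i by (subst foldl_add_vec[of _ k]) auto
  then show "\<lfloor>u $ i\<rfloor> + disp as i = \<lfloor>foldl (+) u as $ i\<rfloor>"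
    using lattice_Ints[OF assms(1) i] i by (auto simp: disp_def elim!: Ints_cases)
qed auto

lemma alternant_reflection:
  assumes "\<alpha> \<in> wall_normals k" "v \<in> lattice_span k A"
  shows "alternant k (\<lambda>i. \<lfloor>reflection \<alpha> v $ i\<rfloor>) x = - alternant k (\<lambda>i. \<lfloor>v $ i\<rfloor>) x"
proof -
  have c: "v \<in> carrier_vec k" using assms(2) by (rule lattice_carrier)
  consider i j where "i < j" "j < k" "\<alpha> = unit_vec k i - unit_vec k j" | "\<alpha> = unit_vec k 0"
    using assms by (auto simp: wall_normals_def)
  then show ?thesis
  proof cases
    case 1
    have "alternant k (\<lambda>i. \<lfloor>reflection \<alpha> v $ i\<rfloor>) x = alternant k ((\<lambda>i. \<lfloor>v $ i\<rfloor>) \<circ> Transposition.transpose i j) x"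
      by (rule alternant_cong) (use 1 c in \<open>auto simp: reflection_swap\<close>)
    then show ?thesis using 1 by (simp add: alternant_swap)
  next
    case 2
    have "alternant k (\<lambda>i. \<lfloor>reflection \<alpha> v $ i\<rfloor>) x = alternant k ((\<lambda>i. \<lfloor>v $ i\<rfloor>)(0 := - \<lfloor>v $ 0\<rfloor>)) x"
      by (rule alternant_cong)
         (use 2 c k_pos lattice_Ints[OF assms(2) k_pos] in \<open>auto simp: reflection_flip elim!: Ints_cases\<close>)
    then show ?thesis using alternant_negate[OF k_pos, of "\<lambda>i. \<lfloor>v $ i\<rfloor>"] by simp
  qed
qed

text \<open>
  Reflecting the part of the step after the first exit in the wall that was hit is a
  weight-preserving involution, and it changes the sign of the alternant of the end point.
\<close>

lemma leaving_steps_cancel: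
  assumes u: "u \<in> weyl_chamber k" "u \<in> lattice_span k A"
  shows "(\<Sum>as | as \<in> S \<and> \<not> stays u as. of_real (w as) * alternant k (\<lambda>i. \<lfloor>foldl (+) u as $ i\<rfloor>) x) = 0"
proof -
  define out where "out = (\<lambda>as i. i \<le> length as \<and> foldl (+) u (take i as) \<notin> weyl_chamber k)"
  define exit where "exit = (\<lambda>as. LEAST i. out as i)"
  \<comment> \<open>The wall is chosen as a function of the exit point alone. Reflecting the rest of
    the step keeps the exit point, so the same wall is chosen again and the map is an
    involution.\<close>
  define wall where "wall = (\<lambda>q. SOME \<alpha>. \<alpha> \<in> wall_normals k \<and> reflection \<alpha> q = q)"
  define q where "q = (\<lambda>as. foldl (+) u (take (exit as) as))"
  define \<phi> where "\<phi> = (\<lambda>as. take (exit as) as @ map (reflection (wall (q as))) (drop (exit as) as))"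
  define f where "f = (\<lambda>as. of_real (w as) * alternant k (\<lambda>i. \<lfloor>foldl (+) u as $ i\<rfloor>) x)"
  let ?B = "{as \<in> S. \<not> stays u as}"
  have B: "\<phi> as \<in> ?B \<and> \<phi> (\<phi> as) = as \<and> f (\<phi> as) = - f as" if "as \<in> ?B" for as
  proof -
    have as: "as \<in> S" and "\<exists>i. out as i" using that by (auto simp: stays_def out_def)
    then have ex: "out as (exit as)" and least: "\<And>j. j < exit as \<Longrightarrow> \<not> out as j"
      unfolding exit_def by (auto intro: LeastI_ex dest: not_less_Least)
    define i where "i = exit as"
    have i: "i \<le> length as" and qi: "q as = foldl (+) u (take i as)" and q_out: "q as \<notin> weyl_chamber k"
      using ex by (auto simp: out_def i_def q_def)
    \<comment> \<open>The start lies in the chamber, so an atomic step precedes the exit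
      point.\<close>
    have "i \<noteq> 0" using q_out u by (metis qi take0 foldl_Nil)
    then obtain m where m: "i = Suc m" by (cases i) auto
    have sub: "set (take j as) \<subseteq> A" for j using set_step[OF as] set_take_subset[of j as] by blast
    have "foldl (+) u (take m as) \<in> weyl_chamber k"
      using least[of m] m i by (auto simp: out_def i_def)
    moreover have "foldl (+) u (take m as) \<in> lattice_span k A"
      by (rule sum_lattice[OF u(2) sub])
    moreover have "q as = foldl (+) u (take m as) + as ! m"
      using i unfolding qi m by (simp add: take_Suc_conv_app_nth)
    moreover have "as ! m \<in> A" using set_step[OF as] i m by auto
    ultimately have "\<exists>\<alpha>. \<alpha> \<in> wall_normals k \<and> reflection \<alpha> (q as) = q as"
      using wall_hit q_out by metis
    then have wall: "wall (q as) \<in> wall_normals k" "reflection (wall (q as)) (q as) = q as"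
      unfolding wall_def by (metis (mono_tags, lifting) someI_ex)+
    let ?r = "reflection (wall (q as))"
    have \<phi>_unfold: "\<phi> bs = take (exit bs) bs @ map (reflection (wall (q bs))) (drop (exit bs) bs)" for bs
      by (simp add: \<phi>_def)
    have \<phi>: "\<phi> as = take i as @ map ?r (drop i as)" by (simp add: \<phi>_def i_def)
    have \<phi>S: "\<phi> as \<in> S" "w (\<phi> as) = w as"
      unfolding \<phi> by (rule reflect_suffix[OF as wall(1) i])+
    have take: "take j (\<phi> as) = take j as" if "j \<le> i" for j
      using that i by (simp add: \<phi> min_def)
    have len: "length (\<phi> as) = length as" by (simp add: \<phi>)
    have out: "out (\<phi> as) j \<longleftrightarrow> out as j" if "j \<le> i" for j
      using take[OF that] by (simp add: out_def len)
    have exit: "exit (\<phi> as) = i"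
      unfolding exit_def
    proof (rule Least_equality)
      show "out (\<phi> as) i" using out[of i] ex by (simp add: i_def)
      fix j assume "out (\<phi> as) j"
      then show "i \<le> j" using out[of j] least[of j] by (cases "j < i") (auto simp: i_def)
    qed
    have "q (\<phi> as) = q as" using take[of i] by (simp add: q_def exit i_def)
    then have "\<phi> (\<phi> as) = take i (\<phi> as) @ map ?r (drop i (\<phi> as))"
      using \<phi>_unfold[of "\<phi> as"] exit by simp
    also have "\<dots> = take i as @ map ?r (map ?r (drop i as))"
      using i by (simp add: take) (simp add: \<phi> min_def)
    also have "map ?r (map ?r (drop i as)) = drop i as"
      unfolding map_map
      by (rule map_idI) (use set_step_carrier[OF as] wall k_pos in
          \<open>auto intro!: reflection_reflection dest: in_set_dropD\<close>)
    finally have inv: "\<phi> (\<phi> as) = as" by simp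
    have bad: "\<not> stays u (\<phi> as)"
      using out[of i] ex unfolding stays_def out_def i_def by auto
    \<comment> \<open>The exit point is fixed by the reflection, so the modified step ends at the
      mirror image of the original end point.\<close>
    have "foldl (+) u (\<phi> as) = foldl (+) (?r (q as)) (map ?r (drop i as))"
      by (simp add: \<phi> qi[symmetric] wall(2))
    also have "\<dots> = ?r (foldl (+) (q as) (drop i as))"
    proof (rule foldl_map_reflection[of _ k])
      show "q as \<in> carrier_vec k" unfolding qi using sum_lattice[OF u(2) sub] by (rule lattice_carrier)
      show "set (drop i as) \<subseteq> carrier_vec k" using set_step_carrier[OF as] by (auto dest: in_set_dropD)
    qed (use wall k_pos wall_normals_carrier in auto)
    also have "foldl (+) (q as) (drop i as) = foldl (+) u as"
      unfolding qi by (metis append_take_drop_id foldl_append)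
    finally have "alternant k (\<lambda>i. \<lfloor>foldl (+) u (\<phi> as) $ i\<rfloor>) x = - alternant k (\<lambda>i. \<lfloor>foldl (+) u as $ i\<rfloor>) x"
      using alternant_reflection[OF wall(1) sum_lattice[OF u(2) set_step[OF as]]] by simp
    then have "f (\<phi> as) = - f as" by (simp add: f_def \<phi>S)
    with inv bad \<phi>S show ?thesis by simp
  qed
  have "sum f ?B = (\<Sum>as\<in>?B. f (\<phi> as))"
    by (rule sum.reindex_bij_witness[of ?B \<phi> \<phi>]) (use B in auto)
  also have "\<dots> = - sum f ?B"
    unfolding sum_negf[symmetric] by (rule sum.cong) (use B in auto)
  finally show ?thesis by (simp add: f_def)
qed

text \<open>Multiplication by the generating function acts on alternants as one composite step
  inside the chamber: the leaving steps sum to 0.\<close>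

lemma alternant_mult_step_gf_chamber:
  assumes u: "u \<in> weyl_chamber k" "u \<in> lattice_span k A" and nz: "\<And>j. j < k \<Longrightarrow> x j \<noteq> 0"
  shows "alternant k (\<lambda>i. \<lfloor>u $ i\<rfloor>) x * step_gf k S w (vec k x) =
    (\<Sum>as | as \<in> S \<and> stays u as. of_real (w as) * alternant k (\<lambda>i. \<lfloor>foldl (+) u as $ i\<rfloor>) x)"
proof -
  define f where "f = (\<lambda>as. of_real (w as) * alternant k (\<lambda>i. \<lfloor>foldl (+) u as $ i\<rfloor>) x)"
  have "alternant k (\<lambda>i. \<lfloor>u $ i\<rfloor>) x * step_gf k S w (vec k x) = sum f S"
    unfolding f_def by (subst alternant_mult_step_gf[OF nz]) (auto intro!: sum.cong simp: alternant_endpoint u)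
  also have "sum f S = sum f ({as. as \<in> S \<and> stays u as} \<union> {as. as \<in> S \<and> \<not> stays u as})"
    by (rule sum.cong) auto
  also have "\<dots> = (\<Sum>as | as \<in> S \<and> stays u as. f as) + (\<Sum>as | as \<in> S \<and> \<not> stays u as. f as)"
    using finite_S by (intro sum.union_disjoint) auto
  finally show ?thesis
    using leaving_steps_cancel[OF u, of x] by (simp add: f_def)
qed

section \<open>The integral representation of the walk counts\<close>

lemma has_torus_integral_walks:
  assumes r: "r > 0" and u: "u \<in> weyl_chamber k" "u \<in> lattice_span k A"
  shows "has_torus_integral r k (\<lambda>x. alternant k (\<lambda>i. \<lfloor>u $ i\<rfloor>) x * kern k x * step_gf k S w (vec k x) ^ n)
    ((2 * complex_of_real pi * \<i>) ^ k * fact k * of_real (free_walk_count k S w n u))"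
  using u
\<comment> \<open>The first composite step is split off, so the induction hypothesis is applied at
  new starting points.\<close>
proof (induction n arbitrary: u)
  case 0
  \<comment> \<open>On integer coordinates the floor is exact, so positivity and strict order carry
    over to the exponents.\<close>
  have "u $ i \<in> \<int>" if "i < k" for i using lattice_Ints[OF 0(2) that] .
  then have "has_torus_integral r k (\<lambda>x. alternant k (\<lambda>i. \<lfloor>u $ i\<rfloor>) x * kern k x) ((2 * complex_of_real pi * \<i>) ^ k * fact k)"
  proof (intro has_torus_integral_alternant_kern r)
    assume int: "\<And>i. i < k \<Longrightarrow> u $ i \<in> \<int>"
    show "0 < \<lfloor>u $ m\<rfloor>" if "m < k" for m
      using int[OF that] 0(1) that by (auto simp: weyl_chamber_def elim!: Ints_cases)
    show "\<lfloor>u $ l\<rfloor> < \<lfloor>u $ m\<rfloor>" if lm: "l < m" "m < k" for l m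
    proof -
      have "u $ l < u $ m" using 0(1) lm by (auto simp: weyl_chamber_def)
      moreover obtain a b where "u $ l = of_int a" "u $ m = of_int b"
        using int[of l] int[of m] lm by (auto elim!: Ints_cases)
      ultimately show ?thesis by simp
    qed
  qed
  then show ?case by (simp add: free_walk_count_0 0)
next
  case (Suc n)
  let ?c = "(2 * complex_of_real pi * \<i>) ^ k * fact k"
  let ?f = "\<lambda>u n x. alternant k (\<lambda>i. \<lfloor>u $ i\<rfloor>) x * kern k x * step_gf k S w (vec k x) ^ n"
  have "has_torus_integral r k (\<lambda>x. \<Sum>as | as \<in> S \<and> stays u as. of_real (w as) * ?f (foldl (+) u as) n x)
     (\<Sum>as | as \<in> S \<and> stays u as. of_real (w as) * (?c * of_real (free_walk_count k S w n (foldl (+) u as))))"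
  proof (intro has_torus_integral_sum has_torus_integral_cmult Suc.IH)
    fix as assume as: "as \<in> {as. as \<in> S \<and> stays u as}"
    then show "foldl (+) u as \<in> weyl_chamber k"
      unfolding stays_def by (metis (mono_tags, lifting) mem_Collect_eq order_refl take_all)
    show "foldl (+) u as \<in> lattice_span k A"
      using as Suc.prems set_step by (intro sum_lattice) auto
  qed (use finite_S in auto)
  also have "(\<Sum>as | as \<in> S \<and> stays u as. of_real (w as) * (?c * of_real (free_walk_count k S w n (foldl (+) u as)))) =
     ?c * of_real (free_walk_count k S w (Suc n) u)"
    unfolding free_walk_count_Suc by (simp add: sum_distrib_left mult_ac)
  finally show ?case
  proof (rule has_torus_integral_cong)
    show "generic k (\<lambda>x. (\<Sum>as | as \<in> S \<and> stays u as. of_real (w as) * ?f (foldl (+) u as) n x) = ?f u (Suc n) x)"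
    proof (rule generic_mono[OF generic_regular])
      fix x assume "regular k x"
      then have nz: "\<And>j. j < k \<Longrightarrow> x j \<noteq> 0" by (simp add: regular_def)
      have "?f u (Suc n) x = (alternant k (\<lambda>i. \<lfloor>u $ i\<rfloor>) x * step_gf k S w (vec k x)) * kern k x * step_gf k S w (vec k x) ^ n"
        by (simp add: mult_ac)
      also have "\<dots> = (\<Sum>as | as \<in> S \<and> stays u as. of_real (w as) * alternant k (\<lambda>i. \<lfloor>foldl (+) u as $ i\<rfloor>) x) *
          kern k x * step_gf k S w (vec k x) ^ n"
        by (subst alternant_mult_step_gf_chamber[OF Suc.prems]) (use nz in auto)
      also have "\<dots> = (\<Sum>as | as \<in> S \<and> stays u as. of_real (w as) * ?f (foldl (+) u as) n x)"
        by (simp add: sum_distrib_right mult.assoc)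
      finally show "(\<Sum>as | as \<in> S \<and> stays u as. of_real (w as) * ?f (foldl (+) u as) n x) = ?f u (Suc n) x"
        by (rule sym)
    qed
  qed
qed

end

text \<open>The integrand equals the alternant of \<open>u\<close> times \<open>kern\<close> and the
  power of the generating function at every regular point, hence generically. The constant is the
  value of the integral for \<open>n = 0\<close>.\<close>

theorem theorem2:
  fixes k n :: nat and \<rho> :: real
    and A :: "real vec set" and S :: "real vec list set" and w :: "real vec list \<Rightarrow> real"
    and u :: "real vec"
  assumes "k \<ge> 1"
    and "A = axis_steps k \<or> A = diagonal_steps k"
    and "composite_step_set k A S"
    and "step_weight k S w"
    and "u \<in> weyl_chamber k \<inter> lattice_span k A"
    and "\<rho> > 0"
  shows "complex_of_real (free_walk_count k S w n u) =
    1 / ((2 * complex_of_real pi * \<i>) ^ k * fact k) *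
    torus_integral \<rho> k (\<lambda>z.
      det_of k (\<lambda>j m. (z $ j) ^ (m + 1)) *
      det_of k (\<lambda>j m. (z $ j) powi (- int (m + 1))) *
      (det_of k (\<lambda>j m. (z $ j) powi \<lfloor>u $ m\<rfloor> - (z $ j) powi (- \<lfloor>u $ m\<rfloor>)) /
       det_of k (\<lambda>j m. (z $ j) ^ (m + 1) - (z $ j) powi (- int (m + 1)))) *
      step_gf k S w z ^ n *
      (\<Prod>j<k. (z $ j + 1) / z $ j))"
proof -
  interpret step_model k A S w
    by unfold_locales (use assms in auto)
  define f where "f = (\<lambda>z.
      det_of k (\<lambda>j m. (z $ j) ^ (m + 1)) *
      det_of k (\<lambda>j m. (z $ j) powi (- int (m + 1))) *
      (det_of k (\<lambda>j m. (z $ j) powi \<lfloor>u $ m\<rfloor> - (z $ j) powi (- \<lfloor>u $ m\<rfloor>)) /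
       det_of k (\<lambda>j m. (z $ j) ^ (m + 1) - (z $ j) powi (- int (m + 1)))) *
      step_gf k S w z ^ n *
      (\<Prod>j<k. (z $ j + 1) / z $ j))"
  have det_vec: "det_of k (\<lambda>j m. g (vec k x $ j) m) = det_of k (\<lambda>j m. g (x j) m)" for g :: "complex \<Rightarrow> nat \<Rightarrow> complex" and x
    by (rule arg_cong[where f = det], rule cong_mat) auto
  have prod_vec: "(\<Prod>j<k. (vec k x $ j + 1) / vec k x $ j) = (\<Prod>j<k. (x j + 1) / x j)" for x :: "nat \<Rightarrow> complex"
    by (rule prod.cong) auto
  have u: "u \<in> weyl_chamber k" "u \<in> lattice_span k A" using assms(5) by auto
  have "torus_integral \<rho> k f = (2 * complex_of_real pi * \<i>) ^ k * fact k * of_real (free_walk_count k S w n u)"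
  proof (rule torus_integral_eqI[OF has_torus_integral_cong[OF has_torus_integral_walks[OF assms(6) u]] assms(6)])
    show "generic k (\<lambda>x. alternant k (\<lambda>i. \<lfloor>u $ i\<rfloor>) x * kern k x * step_gf k S w (vec k x) ^ n = f (vec k x))"
    proof (rule generic_mono[OF generic_regular])
      fix x assume "regular k x"
      from integrand_eq_kern[OF this, of "alternant k (\<lambda>i. \<lfloor>u $ i\<rfloor>) x" "step_gf k S w (vec k x) ^ n"]
      show "alternant k (\<lambda>i. \<lfloor>u $ i\<rfloor>) x * kern k x * step_gf k S w (vec k x) ^ n = f (vec k x)"
        unfolding f_def prod_vec det_vec[of "\<lambda>y m. y ^ (m + 1)"] det_vec[of "\<lambda>y m. y powi (- int (m + 1))"]
          det_vec[of "\<lambda>y m. y powi \<lfloor>u $ m\<rfloor> - y powi (- \<lfloor>u $ m\<rfloor>)"] det_vec[of "\<lambda>y m. y ^ (m + 1) - y powi (- int (m + 1))"]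
          alternant_def by (rule sym)
    qed
  qed
  then show ?thesis unfolding f_def[symmetric] by simp
qed

end
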